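(* Let $1\le p<\infty$ and let $f\in \mathcal U_p(\mathbb{R}^2)$. Then $f\in S_0(\mathbb{R}^2)$, and $f$ can be modified on a set of (two-dimensional Lebesgue) measure zero so as to become a bounded and uniformly continuous function $\bar f$ on $\mathbb{R}^2$. Moreover, setting $$\varphi_1(y)=\|f_y\|^*_{\operatorname{Lip}\frac1p},\qquad \varphi_2(x)=\|f_x\|^*_{\operatorname{Lip}\frac1p},$$ there is a constant $c>0$ depending only on $p$ such that $$\|f\|_{L^\infty(\mathbb{R}^2)}\le c\left(\|\varphi_1\|_{L^{p,1}(\mathbb{R})}+\|\varphi_2\|_{L^{p,1}(\mathbb{R})}\right)$$ and, for every $\delta>0$, $$\omega(\bar f;\delta)\le c\int_0^\delta\left[\varphi_1^*(t)+\varphi_2^*(t)\right]t^{1/p-1}\,dt.$$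
   Context: For a function $f$ on $\mathbb{R}^2$ and $x\in\mathbb{R}$, the $x$-section is $f_x(y)=f(x,y)$ ($y\in\mathbb{R}$); for $y\in\mathbb{R}$, the $y$-section is $f_y(x)=f(x,y)$ ($x\in\mathbb{R}$). For $\varphi$ on $\mathbb{R}$, $\Delta_h\varphi(t)=\varphi(t+h)-\varphi(t)$. For $\alpha\in(0,1]$, $\operatorname{Lip}\alpha$ is the class of $\varphi\in L^\infty(\mathbb{R})$ with $\|\varphi\|^*_{\operatorname{Lip}\alpha}=\sup_{h>0}h^{-\alpha}\|\Delta_h\varphi\|_\infty<\infty$ (here $\|\cdot\|_\infty$ is the essential supremum), and $\|\varphi\|_{\operatorname{Lip}\alpha}=\|\varphi\|_\infty+\|\varphi\|^*_{\operatorname{Lip}\alpha}$. $S_0(\mathbb{R}^n)$ is the class of measurable, a.e. finite functions $f$ on $\mathbb{R}^n$ with $\lambda_f(s)=|\{x:|f(x)|>s\}|<\infty$ for every $s>0$. The non-increasing rearrangement $f^*$ of $f\in S_0(\mathbb{R}^n)$ is the non-negative non-increasing function on $(0,\infty)$ equimeasurable with $|f|$. For $1\le p,q<\infty$, $L^{p,q}(\mathbb{R}^n)$ is the set of $f\in S_0(\mathbb{R}^n)$ with $\|f\|_{L^{p,q}}=\left(\int_0^\infty (t^{1/p}f^*(t))^q\,\frac{dt}{t}\right)^{1/q}<\infty$. For $1\le p<\infty$, $\mathcal U_p(\mathbb{R}^2)$ is the set of measurable $f$ on $\mathbb{R}^2$ such that almost every $x$-section and almost every $y$-section belong to $\operatorname{Lip}\frac1p$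 and the functions $y\mapsto \|f_y\|_{\operatorname{Lip}\frac1p}$ and $x\mapsto\|f_x\|_{\operatorname{Lip}\frac1p}$ belong to $L^{p,1}(\mathbb{R})$; its norm is $\|f\|_{\mathcal U_p}=\|y\mapsto\|f_y\|_{\operatorname{Lip}\frac1p}\|_{L^{p,1}}+\|x\mapsto\|f_x\|_{\operatorname{Lip}\frac1p}\|_{L^{p,1}}$. For a continuous $F$ on $\mathbb{R}^2$, $\omega(F;\delta)=\sup_{0\le h,k\le\delta}\sup_{(x,y)}|F(x+h,y+k)-F(x,y)|$. *)

theory Defs
  imports "HOL-Analysis.Analysis"
begin

definition ess_norm :: "('a::euclidean_space \<Rightarrow> real) \<Rightarrow> ereal" where
  "ess_norm f = Inf {C::ereal. AE x in lebesgue. ereal \<bar>f x\<bar> \<le> C}"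

definition diff_op :: "real \<Rightarrow> (real \<Rightarrow> real) \<Rightarrow> real \<Rightarrow> real" where
  "diff_op h \<phi> t = \<phi> (t + h) - \<phi> t"

definition lip_semi :: "real \<Rightarrow> (real \<Rightarrow> real) \<Rightarrow> ereal" where
  "lip_semi \<alpha> \<phi> = (SUP h\<in>{0<..}. ereal (h powr (-\<alpha>)) * ess_norm (diff_op h \<phi>))"

definition in_Lip :: "real \<Rightarrow> (real \<Rightarrow> real) \<Rightarrow> bool" where
  "in_Lip \<alpha> \<phi> \<longleftrightarrow> \<phi> \<in> borel_measurable lebesgue \<and> ess_norm \<phi> < \<infinity> \<and> lip_semi \<alpha> \<phi> < \<infinity>"

definition lip_norm :: "real \<Rightarrow> (real \<Rightarrow> real) \<Rightarrow> real" where
  "lip_norm \<alpha> \<phi> = real_of_ereal (ess_norm \<phi> + lip_semi \<alpha> \<phi>)"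

definition S0 :: "('a::euclidean_space \<Rightarrow> real) \<Rightarrow> bool" where
  "S0 f \<longleftrightarrow> f \<in> borel_measurable lebesgue \<and>
     (\<forall>s>0. emeasure lebesgue {x. s < \<bar>f x\<bar>} < \<infinity>)"

definition rearr :: "('a::euclidean_space \<Rightarrow> real) \<Rightarrow> real \<Rightarrow> real" where
  "rearr f t = Inf {s::real. 0 \<le> s \<and> emeasure lebesgue {x. s < \<bar>f x\<bar>} \<le> ennreal t}"

definition Lp1_enorm :: "real \<Rightarrow> ('a::euclidean_space \<Rightarrow> real) \<Rightarrow> ennreal" where
  "Lp1_enorm p f = (\<integral>\<^sup>+ t\<in>{0<..}. ennreal (t powr (1/p) * rearr f t / t) \<partial>lborel)"

definition in_Lp1 :: "real \<Rightarrow> ('a::euclidean_space \<Rightarrow> real) \<Rightarrow> bool" where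
  "in_Lp1 p f \<longleftrightarrow> S0 f \<and> Lp1_enorm p f < \<infinity>"

definition Lp1_norm :: "real \<Rightarrow> ('a::euclidean_space \<Rightarrow> real) \<Rightarrow> real" where
  "Lp1_norm p f = enn2real (Lp1_enorm p f)"

definition in_Up :: "real \<Rightarrow> (real \<times> real \<Rightarrow> real) \<Rightarrow> bool" where
  "in_Up p f \<longleftrightarrow> f \<in> borel_measurable lebesgue \<and>
     (AE x in lebesgue. in_Lip (1/p) (\<lambda>y. f (x, y))) \<and>
     (AE y in lebesgue. in_Lip (1/p) (\<lambda>x. f (x, y))) \<and>
     in_Lp1 p (\<lambda>y. lip_norm (1/p) (\<lambda>x. f (x, y))) \<and>
     in_Lp1 p (\<lambda>x. lip_norm (1/p) (\<lambda>y. f (x, y)))"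

definition omega :: "(real \<times> real \<Rightarrow> real) \<Rightarrow> real \<Rightarrow> real" where
  "omega F \<delta> = (SUP hk\<in>{0..\<delta>}\<times>{0..\<delta>}. SUP z\<in>UNIV.
      \<bar>F (fst z + fst hk, snd z + snd hk) - F z\<bar>)"

end

theory Submission
  imports Defs
begin

text \<open>
  After replacing \<open>f\<close> by a Borel function and discarding a null set, rows and columns of \<open>f\<close> are
  exactly Hoelder of order \<open>1/p\<close> with constants \<open>\<phi>1(y)\<close> and \<open>\<phi>2(x)\<close>. Put \<open>M = \<phi>1\<^sup>* + \<phi>2\<^sup>*\<close>.
  The rows and columns whose constant exceeds \<open>M(\<rho>/2)\<close> have measure at most \<open>\<rho>/2\<close>, so every
  interval of length \<open>\<rho>\<close> contains good ones. Two points at distance at most \<open>\<delta>\<close> in each coordinate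
  are joined through a common good grid point; from there one descends to each of them through good
  grid points of scales \<open>\<rho> = \<delta> / 2\<^sup>n\<close>, alternating horizontal and vertical moves. A move at scale
  \<open>\<rho>\<close> costs at most \<open>M(\<rho>/4) (2\<rho>)\<^bsup>1/p\<^esup>\<close>, and these costs sum to a multiple of
  \<open>\<integral>\<^sub>0\<^sup>\<delta> M(t) t\<^bsup>1/p-1\<^esup> dt\<close>. Hence \<open>f\<close> is uniformly continuous on a dense set of full measure.
  The sup bound follows by letting \<open>\<delta>\<close> grow, since \<open>f\<close> takes arbitrarily small values.
\<close>

subsection \<open>Essential suprema and Lipschitz seminorms\<close>

lemma AE_lebesgue_iff: "(AE x in lebesgue. P x) \<longleftrightarrow> (AE x in lborel. P x)"
  by (rule AE_completion_iff)

text \<open>The measure of the exceptional section is a measurable function of the parameter, and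
  the predicate says that it vanishes. This makes conditions on whole rows and columns
  Borel.\<close>

lemma pred_AE_lborel:
  fixes P :: "'a \<Rightarrow> 'b::euclidean_space \<Rightarrow> bool"
  assumes [measurable]: "Measurable.pred (M \<Otimes>\<^sub>M borel) (\<lambda>z. P (fst z) (snd z))"
  shows "Measurable.pred M (\<lambda>x. AE y in lborel. P x y)"
proof -
  have "(AE y in lborel. P x y) \<longleftrightarrow> emeasure lborel {y \<in> space lborel. \<not> P x y} = 0"
    if "x \<in> space M" for x
  proof -
    have "Measurable.pred borel (\<lambda>y. P (fst (x, y)) (snd (x, y)))"
      using that by measurable
    then show ?thesis
      by (intro AE_iff_measurable) auto
  qed
  moreover have "(\<lambda>x. emeasure lborel {y \<in> space lborel. \<not> P x y}) \<in> borel_measurable M"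
  proof (rule lborel.measurable_emeasure)
    have "{z \<in> space (M \<Otimes>\<^sub>M borel). \<not> P (fst z) (snd z)} \<in> sets (M \<Otimes>\<^sub>M borel)"
      by measurable
    moreover have "sets (M \<Otimes>\<^sub>M lborel) = sets (M \<Otimes>\<^sub>M (borel :: 'b measure))"
      by (intro sets_pair_measure_cong) auto
    ultimately show "{z \<in> space (M \<Otimes>\<^sub>M lborel). snd z \<in> {y \<in> space lborel. \<not> P (fst z) y}} \<in> sets (M \<Otimes>\<^sub>M lborel)"
      by (simp add: space_pair_measure)
  qed auto
  ultimately show ?thesis
    by (simp cong: measurable_cong)
qed

lemma AE_lborel_commute:
  fixes P :: "'a::euclidean_space \<Rightarrow> 'b::euclidean_space \<Rightarrow> bool"
  assumes [measurable]: "Measurable.pred (borel \<Otimes>\<^sub>M borel) (\<lambda>z. P (fst z) (snd z))"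
  shows "(AE x in lborel. AE y in lborel. P x y) \<longleftrightarrow> (AE y in lborel. AE x in lborel. P x y)"
proof -
  have "{z \<in> space (lborel \<Otimes>\<^sub>M lborel). P (fst z) (snd z)} \<in> sets (lborel \<Otimes>\<^sub>M lborel)"
    by measurable
  then show ?thesis
    by (rule lborel_pair.AE_commute)
qed

lemma AE_lborel_prod_iff:
  fixes P :: "'a::euclidean_space \<Rightarrow> 'b::euclidean_space \<Rightarrow> bool"
  assumes [measurable]: "Measurable.pred (borel \<Otimes>\<^sub>M borel) (\<lambda>z. P (fst z) (snd z))"
  shows "(AE z in lborel. P (fst z) (snd z)) \<longleftrightarrow> (AE x in lborel. AE y in lborel. P x y)"
proof -
  have "{z \<in> space (lborel \<Otimes>\<^sub>M lborel). P (fst z) (snd z)} \<in> sets (lborel \<Otimes>\<^sub>M lborel)"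
    by measurable
  then show ?thesis
    unfolding lborel_prod[symmetric] by (rule lborel_pair.AE_pair_iff[symmetric])
qed

text \<open>\<open>P\<close> may be non-measurable, so Fubini is applied to a Borel null set
  \<open>N\<close> containing the exceptional points.\<close>

lemma AE_lebesgue_sections:
  fixes P :: "'a::euclidean_space \<times> 'b::euclidean_space \<Rightarrow> bool"
  assumes "AE z in lebesgue. P z"
  shows "AE x in lborel. AE y in lborel. P (x, y)"
    and "AE y in lborel. AE x in lborel. P (x, y)"
proof -
  obtain N where N: "{z \<in> space lborel. \<not> P z} \<subseteq> N" "emeasure lborel N = 0" and [measurable]: "N \<in> sets borel"
    using assms unfolding AE_lebesgue_iff by (auto elim!: AE_E)
  have "AE z in lborel. z \<notin> N"
    using N(2) by (intro AE_not_in) (simp add: null_sets_def)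
  then have *: "AE x in lborel. AE y in lborel. (x, y) \<notin> N"
    by (subst AE_lborel_prod_iff[symmetric]) (auto simp: borel_prod)
  then have "AE y in lborel. AE x in lborel. (x, y) \<notin> N"
    by (subst AE_lborel_commute[symmetric]) (auto simp: borel_prod)
  then show "AE y in lborel. AE x in lborel. P (x, y)"
    by (rule eventually_mono) (use N(1) in \<open>auto elim!: eventually_mono\<close>)
  show "AE x in lborel. AE y in lborel. P (x, y)"
    using * by (rule eventually_mono) (use N(1) in \<open>auto elim!: eventually_mono\<close>)
qed

lemma AE_lborel_shift:
  fixes a :: "'a::euclidean_space"
  assumes "AE x in lborel. P x"
  shows "AE x in lborel. P (a + x)"
proof -
  have "AE x in distr lborel borel ((+) a). P x"
    using assms by (simp only: lborel_distr_plus)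
  then show ?thesis
    by (rule AE_distrD[rotated]) simp
qed

section \<open>Essential suprema and Hoelder seminorms up to null sets\<close>

lemma AE_abs_le_ess_norm: "AE x in lebesgue. ereal \<bar>f x\<bar> \<le> ess_norm f"
proof -
  let ?S = "{C::ereal. AE x in lebesgue. ereal \<bar>f x\<bar> \<le> C}"
  have "\<infinity> \<in> ?S" by simp
  \<comment> \<open>Countably many admissible bounds already realise the infimum, and their
    exceptional sets have a null union.\<close>
  then obtain c :: "nat \<Rightarrow> ereal" where c: "range c \<subseteq> ?S" "Inf ?S = (INF i. c i)"
    using Inf_countable_INF[of ?S] by blast
  have "AE x in lebesgue. \<forall>i. ereal \<bar>f x\<bar> \<le> c i"
    unfolding AE_all_countable using c(1) by auto
  then show ?thesis
    unfolding ess_norm_def c(2) by eventually_elim (auto intro: INF_greatest)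
qed

lemma ess_norm_le_iff: "ess_norm f \<le> C \<longleftrightarrow> (AE x in lebesgue. ereal \<bar>f x\<bar> \<le> C)"
proof
  assume "ess_norm f \<le> C"
  with AE_abs_le_ess_norm[of f] show "AE x in lebesgue. ereal \<bar>f x\<bar> \<le> C"
    by (auto elim!: eventually_mono)
qed (auto simp: ess_norm_def intro: Inf_lower)

lemma ess_norm_cong:
  assumes "AE x in lebesgue. f x = g x"
  shows "ess_norm f = ess_norm g"
proof -
  have "(AE x in lebesgue. ereal \<bar>f x\<bar> \<le> C) \<longleftrightarrow> (AE x in lebesgue. ereal \<bar>g x\<bar> \<le> C)" for C
    using assms by (intro eventually_subst) (auto elim!: eventually_mono)
  then show ?thesis
    by (simp add: ess_norm_def)
qed

lemma ess_norm_nonneg: "0 \<le> ess_norm (f :: 'a::euclidean_space \<Rightarrow> real)"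
proof -
  \<comment> \<open>The empty set is closed; if its complement were null, it would contain every
    point.\<close>
  have "\<not> (AE x in (lebesgue::'a measure). False)"
    using mem_closed_if_AE_lebesgue[of "{}"] by auto
  moreover have "AE x in (lebesgue::'a measure). False" if "C < 0" "AE x in lebesgue. ereal \<bar>f x\<bar> \<le> C" for C
    using that(2)
  proof eventually_elim
    case (elim x)
    then have "ereal \<bar>f x\<bar> < 0" using that(1) by order
    then show ?case by simp
  qed
  ultimately show ?thesis
    unfolding ess_norm_def by (force intro!: Inf_greatest simp: not_less[symmetric])
qed

text \<open>For each increment the two differences can disagree only on the null set and its
  translate.\<close>

lemma lip_semi_cong:
  assumes "AE x in lebesgue. f x = g x"
  shows "lip_semi \<alpha> f = lip_semi \<alpha> g"
proof -
  have "ess_norm (diff_op h f) = ess_norm (diff_op h g)" for h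
  proof (rule ess_norm_cong)
    have "AE x in lborel. f (h + x) = g (h + x)"
      by (rule AE_lborel_shift) (use assms in \<open>simp add: AE_lebesgue_iff\<close>)
    with assms show "AE x in lebesgue. diff_op h f x = diff_op h g x"
      unfolding AE_lebesgue_iff by eventually_elim (simp add: diff_op_def add.commute)
  qed
  then show ?thesis by (simp add: lip_semi_def)
qed

lemma lip_semi_nonneg: "0 \<le> lip_semi \<alpha> f"
  unfolding lip_semi_def by (rule SUP_upper2[of 1]) (auto simp: ess_norm_nonneg)

text \<open>
  A Hoelder bound for almost every pair of points, instead of for almost every point and a fixed
  increment: in this form it is a Borel condition on a parameter of \<open>f\<close>, and it yields the exact
  bound on a set of full measure.
\<close>

definition ae_holder :: "real \<Rightarrow> real \<Rightarrow> (real \<Rightarrow> real) \<Rightarrow> bool" where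
  "ae_holder \<alpha> C f \<longleftrightarrow> (AE x in lborel. AE x' in lborel. \<bar>f x - f x'\<bar> \<le> C * \<bar>x - x'\<bar> powr \<alpha>)"

lemma lip_semi_le_iff_shift:
  "lip_semi \<alpha> f \<le> ereal C \<longleftrightarrow> (\<forall>h>0. AE x in lborel. \<bar>f (x + h) - f x\<bar> \<le> C * h powr \<alpha>)"
proof -
  have "ereal (h powr - \<alpha>) * E \<le> ereal C \<longleftrightarrow> E \<le> ereal (C * h powr \<alpha>)" if "h > 0" "E \<ge> 0" for h E
    using that by (cases E) (auto simp: powr_minus field_simps)
  then have "lip_semi \<alpha> f \<le> ereal C \<longleftrightarrow> (\<forall>h>0. ess_norm (diff_op h f) \<le> ereal (C * h powr \<alpha>))"
    by (auto simp: lip_semi_def SUP_le_iff ess_norm_nonneg)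
  then show ?thesis
    by (simp add: ess_norm_le_iff diff_op_def AE_lebesgue_iff)
qed

text \<open>Compare \<open>f a\<close> and \<open>f b\<close> through a common point
  \<open>x\<close>, then move \<open>x\<close> to \<open>a\<close>. No continuity of
  \<open>f\<close> is needed: the resulting inequality mentions \<open>x\<close> only in the powers,
  so it defines a closed set, and a closed set of full measure contains \<open>a\<close>.\<close>

lemma holder_of_AE_holder:
  assumes "\<alpha> > 0"
    and a: "AE x in lborel. \<bar>f a - f x\<bar> \<le> C * \<bar>a - x\<bar> powr \<alpha>"
    and b: "AE x in lborel. \<bar>f b - f x\<bar> \<le> C * \<bar>b - x\<bar> powr \<alpha>"
  shows "\<bar>f a - f b :: real\<bar> \<le> C * \<bar>a - b\<bar> powr \<alpha>"
proof -
  let ?S = "{x. \<bar>f a - f b\<bar> \<le> C * \<bar>a - x\<bar> powr \<alpha> + C * \<bar>b - x\<bar> powr \<alpha>}"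
  have "closed ?S"
    using \<open>\<alpha> > 0\<close> by (intro closed_Collect_le continuous_intros continuous_on_powr') auto
  moreover have "AE x in lebesgue. x \<in> ?S"
    unfolding AE_lebesgue_iff using a b by eventually_elim auto
  ultimately have "a \<in> ?S"
    by (rule mem_closed_if_AE_lebesgue)
  then show ?thesis
    using \<open>\<alpha> > 0\<close> by (simp add: abs_minus_commute)
qed

text \<open>The seminorm has an exceptional set for each increment; Fubini exchanges these for an
  exceptional set for each base point. Conversely, for a fixed \<open>h\<close> almost every
  \<open>x\<close> is good together with \<open>x + h\<close>, and two good points satisfy the exact
  bound.\<close>

lemma lip_semi_le_iff_ae_holder:
  assumes "\<alpha> > 0" and [measurable]: "f \<in> borel_measurable borel"
  shows "lip_semi \<alpha> f \<le> ereal C \<longleftrightarrow> ae_holder \<alpha> C f"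
proof
  assume "lip_semi \<alpha> f \<le> ereal C"
  then have "AE x in lborel. h > 0 \<longrightarrow> \<bar>f (x + h) - f x\<bar> \<le> C * h powr \<alpha>" for h
    unfolding lip_semi_le_iff_shift by (cases "h > 0") auto
  then have "AE h in lborel. AE x in lborel. h > 0 \<longrightarrow> \<bar>f (x + h) - f x\<bar> \<le> C * h powr \<alpha>"
    by (rule AE_I2)
  then have "AE x in lborel. AE h in lborel. h > 0 \<longrightarrow> \<bar>f (x + h) - f x\<bar> \<le> C * h powr \<alpha>"
    by (rule AE_lborel_commute[THEN iffD1, rotated]) measurable
  \<comment> \<open>Translation by \<open>- x\<close> turns the increment into a second point,
    \<open>h = x' - x\<close>.\<close>
  then have gt: "AE x in lborel. AE x' in lborel. x' > x \<longrightarrow> \<bar>f x - f x'\<bar> \<le> C * \<bar>x - x'\<bar> powr \<alpha>"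
  proof eventually_elim
    case (elim x)
    show ?case
      using AE_lborel_shift[OF elim, of "- x"]
      by eventually_elim (auto simp: abs_minus_commute)
  qed
  \<comment> \<open>Positive increments reach only \<open>x' > x\<close>; exchanging the two
    variables gives the other half.\<close>
  have *: "AE x in lborel. AE x' in lborel. x > x' \<longrightarrow> \<bar>f x' - f x\<bar> \<le> C * \<bar>x' - x\<bar> powr \<alpha>"
    using gt by (rule AE_lborel_commute[THEN iffD1, rotated]) measurable
  show "ae_holder \<alpha> C f"
    unfolding ae_holder_def using gt *
  proof eventually_elim
    case (elim x)
    then show ?case
    proof eventually_elim
      case (elim x')
      then show ?case
        by (cases x x' rule: linorder_cases) (auto simp: abs_minus_commute)
    qed
  qed
next
  assume holder: "ae_holder \<alpha> C f"
  show "lip_semi \<alpha> f \<le> ereal C"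
    unfolding lip_semi_le_iff_shift
  proof safe
    fix h :: real assume "h > 0"
    show "AE x in lborel. \<bar>f (x + h) - f x\<bar> \<le> C * h powr \<alpha>"
      using holder[unfolded ae_holder_def] AE_lborel_shift[OF holder[unfolded ae_holder_def], of h]
    proof eventually_elim
      case (elim x)
      then show ?case
        using holder_of_AE_holder[OF \<open>\<alpha> > 0\<close> elim(2,1)] \<open>h > 0\<close> by (simp add: add.commute)
    qed
  qed
qed

lemma borel_measurable_lip_semi:
  fixes G :: "'a::euclidean_space \<times> real \<Rightarrow> real"
  assumes "\<alpha> > 0" and [measurable]: "G \<in> borel_measurable (borel \<Otimes>\<^sub>M borel)"
  shows "(\<lambda>y. real_of_ereal (lip_semi \<alpha> (\<lambda>x. G (y, x)))) \<in> borel_measurable borel"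
proof -
  let ?L = "\<lambda>y. lip_semi \<alpha> (\<lambda>x. G (y, x))"
  have sect: "(\<lambda>x. G (y, x)) \<in> borel_measurable borel" for y
    by measurable
  have "Measurable.pred borel (\<lambda>y. ae_holder \<alpha> C (\<lambda>x. G (y, x)))" for C
    unfolding ae_holder_def by (intro pred_AE_lborel) measurable
  then have [measurable]: "Measurable.pred borel (\<lambda>y. ?L y \<le> ereal C)" for C
    by (simp add: lip_semi_le_iff_ae_holder[OF \<open>\<alpha> > 0\<close> sect])
  \<comment> \<open>\<open>real_of_ereal\<close> sends \<infinity> to 0, so for
    \<open>a \<ge> 0\<close> the sublevel set also contains the parameters whose seminorm is
    infinite, that is, bounded by no natural number.\<close>
  have "real_of_ereal E \<le> a \<longleftrightarrow> 0 \<le> a \<and> (E \<le> ereal a \<or> (\<forall>n::nat. \<not> E \<le> ereal n))" if "E \<ge> 0" for E a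
  proof (cases E)
    case (real r)
    have "\<exists>n. r \<le> real n" by (rule real_arch_simple)
    with real that show ?thesis by auto
  qed (use that in auto)
  then have eq: "{y \<in> space borel. real_of_ereal (?L y) \<le> a}
      = {y \<in> space borel. 0 \<le> a \<and> (?L y \<le> ereal a \<or> (\<forall>n::nat. \<not> ?L y \<le> ereal n))}" for a
    using lip_semi_nonneg by metis
  show ?thesis
    unfolding borel_measurable_iff_le eq by (intro allI) measurable
qed

subsection \<open>Rearrangements\<close>

lemma S0_mono:
  assumes g: "S0 g" and [measurable]: "f \<in> borel_measurable lebesgue"
    and le: "AE x in lebesgue. \<bar>f x\<bar> \<le> \<bar>g x\<bar>"
  shows "S0 f"
  unfolding S0_def
proof safe
  fix s :: real assume "s > 0"
  have [measurable]: "g \<in> borel_measurable lebesgue"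
    using g by (simp add: S0_def)
  have "emeasure lebesgue {x. s < \<bar>f x\<bar>} \<le> emeasure lebesgue {x. s < \<bar>g x\<bar>}"
  proof (rule emeasure_mono_AE)
    have "{x \<in> space lebesgue. s < \<bar>g x\<bar>} \<in> sets lebesgue" by measurable
    then show "{x. s < \<bar>g x\<bar>} \<in> sets lebesgue" by simp
  qed (use le in \<open>auto elim!: eventually_mono\<close>)
  also have "\<dots> < \<infinity>"
    using g \<open>s > 0\<close> by (simp add: S0_def)
  finally show "emeasure lebesgue {x. s < \<bar>f x\<bar>} < \<infinity>" .
qed fact

lemma level_set_lebesgue:
  assumes [measurable]: "f \<in> borel_measurable lebesgue"
  shows "{x. s < \<bar>f x :: real\<bar>} \<in> sets lebesgue"
proof -
  have "{x \<in> space lebesgue. s < \<bar>f x\<bar>} \<in> sets lebesgue" by measurable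
  then show ?thesis by simp
qed

lemma rearr_cong:
  assumes [measurable]: "f \<in> borel_measurable lebesgue" "g \<in> borel_measurable lebesgue"
    and "AE x in lebesgue. f x = g x"
  shows "rearr f = rearr g"
proof -
  have "emeasure lebesgue {x. s < \<bar>f x\<bar>} = emeasure lebesgue {x. s < \<bar>g x\<bar>}" for s
    using assms(3) by (intro emeasure_eq_AE level_set_lebesgue) (auto elim!: eventually_mono)
  then show ?thesis
    by (simp add: rearr_def fun_eq_iff)
qed

text \<open>The level sets have finite measure and shrink to the empty set, because \<open>f\<close>
  is real-valued. This makes the infimum in \<open>rearr\<close> one over a nonempty set.\<close>

lemma S0_level_ex:
  assumes f: "S0 f" and "t > 0"
  shows "\<exists>s\<ge>0. emeasure lebesgue {x. s < \<bar>f x\<bar>} \<le> ennreal t"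
proof -
  have [measurable]: "f \<in> borel_measurable lebesgue"
    using f by (simp add: S0_def)
  \<comment> \<open>The heights start at 1 because \<open>S0\<close> gives finiteness only at
    positive heights.\<close>
  have "(\<lambda>n. emeasure lebesgue {x. real (Suc n) < \<bar>f x\<bar>})
      \<longlonglongrightarrow> emeasure lebesgue (\<Inter>n. {x. real (Suc n) < \<bar>f x\<bar>})"
  proof (rule Lim_emeasure_decseq)
    show "emeasure lebesgue {x. real (Suc n) < \<bar>f x\<bar>} \<noteq> \<infinity>" for n
      using f by (auto simp: S0_def less_top[symmetric] simp del: of_nat_Suc)
  qed (auto simp: level_set_lebesgue decseq_def)
  also have "(\<Inter>n. {x. real (Suc n) < \<bar>f x\<bar>}) = {}"
  proof safe
    fix x assume "x \<in> (\<Inter>n. {x. real (Suc n) < \<bar>f x\<bar>})"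
    moreover obtain n where "\<bar>f x\<bar> < real n" using reals_Archimedean2 by blast
    ultimately have "real (Suc n) < \<bar>f x\<bar>" "\<bar>f x\<bar> < real n" by auto
    then show "x \<in> {}" by simp
  qed
  finally have "(\<lambda>n. emeasure lebesgue {x. real (Suc n) < \<bar>f x\<bar>}) \<longlonglongrightarrow> 0"
    by simp
  then have "\<forall>\<^sub>F n in sequentially. emeasure lebesgue {x. real (Suc n) < \<bar>f x\<bar>} < ennreal t"
    using \<open>t > 0\<close> by (intro order_tendstoD) auto
  then obtain n where "emeasure lebesgue {x. real (Suc n) < \<bar>f x\<bar>} < ennreal t"
    by (auto simp: eventually_sequentially)
  then show ?thesis
    by (intro exI[of _ "real (Suc n)"]) auto
qed

lemma bdd_below_nonneg: "bdd_below {s::real. 0 \<le> s \<and> P s}"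
  by (rule bdd_belowI[of _ 0]) auto

lemma rearr_nonneg:
  assumes "S0 f" "t > 0"
  shows "0 \<le> rearr f t"
  unfolding rearr_def using S0_level_ex[OF assms] by (intro cInf_greatest) auto

lemma rearr_antimono:
  assumes "S0 f" "0 < s" "s \<le> t"
  shows "rearr f t \<le> rearr f s"
  unfolding rearr_def
proof (rule cInf_superset_mono)
  show "{r. 0 \<le> r \<and> emeasure lebesgue {x. r < \<bar>f x\<bar>} \<le> ennreal s}
      \<subseteq> {r. 0 \<le> r \<and> emeasure lebesgue {x. r < \<bar>f x\<bar>} \<le> ennreal t}"
    using ennreal_leI[OF \<open>s \<le> t\<close>] by (auto intro: order_trans)
qed (use S0_level_ex[OF assms(1,2)] bdd_below_nonneg in auto)

lemma rearr_mono:
  assumes "S0 g" "t > 0" and "f \<in> borel_measurable lebesgue"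
    and le: "AE x in lebesgue. \<bar>f x\<bar> \<le> \<bar>g x\<bar>"
  shows "rearr f t \<le> rearr g t"
  unfolding rearr_def
proof (rule cInf_superset_mono)
  have "emeasure lebesgue {x. s < \<bar>f x\<bar>} \<le> emeasure lebesgue {x. s < \<bar>g x\<bar>}" for s
    using assms(1) by (intro emeasure_mono_AE level_set_lebesgue) (use le in \<open>auto elim!: eventually_mono simp: S0_def\<close>)
  then show "{r. 0 \<le> r \<and> emeasure lebesgue {x. r < \<bar>g x\<bar>} \<le> ennreal t}
      \<subseteq> {r. 0 \<le> r \<and> emeasure lebesgue {x. r < \<bar>f x\<bar>} \<le> ennreal t}"
    by (auto intro: order_trans)
qed (use S0_level_ex[OF assms(1,2)] bdd_below_nonneg in auto)

text \<open>The infimum in \<open>rearr\<close> is attained: the level set at that height is the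
  increasing union of the level sets at slightly larger heights, each of measure at most
  \<open>t\<close>.\<close>

lemma emeasure_rearr_le:
  assumes f: "S0 f" and "t > 0"
  shows "emeasure lebesgue {x. rearr f t < \<bar>f x\<bar>} \<le> ennreal t"
proof -
  let ?A = "\<lambda>n. {x. rearr f t + 1 / real (Suc n) < \<bar>f x\<bar>}"
  have meas: "f \<in> borel_measurable lebesgue"
    using f by (simp add: S0_def)
  have "{x. rearr f t < \<bar>f x\<bar>} = (\<Union>n. ?A n)"
  proof safe
    fix x assume "rearr f t < \<bar>f x\<bar>"
    then have "0 < \<bar>f x\<bar> - rearr f t" by simp
    then obtain n where "1 / real (Suc n) < \<bar>f x\<bar> - rearr f t"
      by (rule nat_approx_posE)
    then have "x \<in> ?A n" by (simp add: less_diff_eq add.commute)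
    then show "x \<in> (\<Union>n. ?A n)" by blast
  next
    fix x n assume "rearr f t + 1 / real (Suc n) < \<bar>f x\<bar>"
    moreover have "0 < 1 / real (Suc n)" by simp
    ultimately show "rearr f t < \<bar>f x\<bar>" by linarith
  qed
  also have "emeasure lebesgue (\<Union>n. ?A n) = (SUP n. emeasure lebesgue (?A n))"
  proof (rule SUP_emeasure_incseq[symmetric])
    show "incseq ?A"
    proof (rule incseq_SucI, safe)
      fix n x assume "rearr f t + 1 / real (Suc n) < \<bar>f x\<bar>"
      moreover have "1 / real (Suc (Suc n)) \<le> 1 / real (Suc n)" by (simp add: field_simps)
      ultimately show "rearr f t + 1 / real (Suc (Suc n)) < \<bar>f x\<bar>" by linarith
    qed
  qed (use level_set_lebesgue[OF meas] in auto)
  also have "\<dots> \<le> ennreal t"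
  proof (rule SUP_least)
    fix n
    let ?S = "{s. 0 \<le> s \<and> emeasure lebesgue {x. s < \<bar>f x\<bar>} \<le> ennreal t}"
    have "Inf ?S < rearr f t + 1 / real (Suc n)"
      unfolding rearr_def[symmetric] by simp
    moreover have "?S \<noteq> {}"
      using S0_level_ex[OF assms] by auto
    ultimately have "\<exists>s\<in>?S. s < rearr f t + 1 / real (Suc n)"
      by (intro cInf_lessD)
    then obtain s where s: "emeasure lebesgue {x. s < \<bar>f x\<bar>} \<le> ennreal t" "s < rearr f t + 1 / real (Suc n)"
      by blast
    have "emeasure lebesgue (?A n) \<le> emeasure lebesgue {x. s < \<bar>f x\<bar>}"
    proof (rule emeasure_mono[OF _ level_set_lebesgue[OF meas]], rule subsetI)
      fix x assume "x \<in> ?A n"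
      with s(2) show "x \<in> {x. s < \<bar>f x\<bar>}" by simp
    qed
    also note s(1)
    finally show "emeasure lebesgue (?A n) \<le> ennreal t" .
  qed
  finally show ?thesis .
qed

section \<open>Measurability of rearrangements and weighted integrals near 0\<close>

lemma borel_measurable_rearr:
  assumes "S0 f"
  shows "rearr f \<in> borel_measurable borel"
proof -
  have "mono_on {0<..} (\<lambda>t. - rearr f t)"
    using assms by (auto simp: mono_on_def rearr_antimono)
  then have "(\<lambda>t. - (- rearr f t)) \<in> borel_measurable (restrict_space borel {0<..})"
    by (intro borel_measurable_uminus borel_measurable_mono_on_fnc)
  then have "(\<lambda>t. if t \<in> {0<..} then rearr f t else rearr f 0) \<in> borel_measurable borel"
    by (subst measurable_If_restrict_space_iff) (auto simp: greaterThan_def)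
  \<comment> \<open>For \<open>t \<le> 0\<close> the value \<open>ennreal t\<close> is 0, so
    \<open>rearr f\<close> is constant there.\<close>
  moreover have "(if t \<in> {0<..} then rearr f t else rearr f 0) = rearr f t" for t
    by (auto simp: rearr_def ennreal_neg)
  ultimately show ?thesis by simp
qed

text \<open>The measure with density \<open>w\<close> is finite on the positive half-line, hence
  continuous along the intervals decreasing to the empty set. This is what makes the modulus bound
  tend to 0.\<close>

lemma nn_integral_Ioc_tendsto_0:
  fixes w :: "real \<Rightarrow> real"
  assumes [measurable]: "w \<in> borel_measurable borel"
    and fin: "(\<integral>\<^sup>+ t\<in>{0<..}. ennreal (w t) \<partial>lborel) < \<infinity>"
  shows "(\<lambda>n. \<integral>\<^sup>+ t\<in>{0<..1 / real (Suc n)}. ennreal (w t) \<partial>lborel) \<longlonglongrightarrow> 0"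
proof -
  have "(\<lambda>n. emeasure (density lborel (\<lambda>t. ennreal (w t))) {0<..1 / real (Suc n)})
     \<longlonglongrightarrow> emeasure (density lborel (\<lambda>t. ennreal (w t))) (\<Inter>n. {0<..1 / real (Suc n)})"
  proof (rule Lim_emeasure_decseq)
    show "decseq (\<lambda>n. {0<..1 / real (Suc n)})"
      by (rule decseq_SucI) (auto simp: field_simps elim!: order_trans)
    fix n
    have "emeasure (density lborel (\<lambda>t. ennreal (w t))) {0<..1 / real (Suc n)}
       \<le> emeasure (density lborel (\<lambda>t. ennreal (w t))) {0<..}"
      by (rule emeasure_mono) auto
    also have "\<dots> < \<infinity>"
      using fin by (simp add: emeasure_density)
    finally show "emeasure (density lborel (\<lambda>t. ennreal (w t))) {0<..1 / real (Suc n)} \<noteq> \<infinity>"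
      by simp
  qed auto
  also have "(\<Inter>n. {0<..1 / real (Suc n)}) = {}"
  proof safe
    fix x assume x: "x \<in> (\<Inter>n. {0<..1 / real (Suc n)})"
    then have "0 < x" by auto
    then obtain n where "1 / real (Suc n) < x"
      by (rule nat_approx_posE)
    moreover have "x \<le> 1 / real (Suc n)" using x by auto
    ultimately show "x \<in> {}" by linarith
  qed
  finally show ?thesis
    by (simp add: emeasure_density)
qed

text \<open>
  \<open>M r (8 r)\<^sup>\<alpha>\<close> is absorbed by the integral over \<open>(r/2, r]\<close>. Keeping the integral over
  \<open>(0, r/2]\<close> on the left lets the dyadic scales telescope without forming an infinite series.
\<close>

lemma dyadic_integral_bound:
  fixes M :: "real \<Rightarrow> real"
  assumes [measurable]: "M \<in> borel_measurable borel"
    and nonneg: "\<And>t. t > 0 \<Longrightarrow> 0 \<le> M t"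
    and anti: "\<And>s t. 0 < s \<Longrightarrow> s \<le> t \<Longrightarrow> M t \<le> M s"
    and \<alpha>: "0 < \<alpha>" "\<alpha> \<le> 1" and "r > 0"
  shows "ennreal (M r * (8 * r) powr \<alpha>) + 16 * (\<integral>\<^sup>+ t\<in>{0<..r / 2}. ennreal (M t * t powr (\<alpha> - 1)) \<partial>lborel)
    \<le> 16 * (\<integral>\<^sup>+ t\<in>{0<..r}. ennreal (M t * t powr (\<alpha> - 1)) \<partial>lborel)"
proof -
  let ?w = "\<lambda>t. ennreal (M t * t powr (\<alpha> - 1))"
  have "(8 * r) powr \<alpha> = 8 powr \<alpha> * r powr \<alpha>"
    using \<open>r > 0\<close> by (simp add: powr_mult)
  also have "\<dots> \<le> 8 * r powr \<alpha>"
    using \<alpha> powr_mono[of \<alpha> 1 8] by (intro mult_right_mono) auto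
  \<comment> \<open>The factor 16 is 8 times the 2 lost by using only the half interval, of length
    \<open>r / 2\<close>.\<close>
  also have "\<dots> = 16 * (r powr (\<alpha> - 1) * (r / 2))"
    using \<open>r > 0\<close> by (simp add: powr_diff)
  finally have "ennreal (M r * (8 * r) powr \<alpha>) \<le> ennreal (M r * (16 * (r powr (\<alpha> - 1) * (r / 2))))"
    using nonneg \<open>r > 0\<close> by (intro ennreal_leI mult_left_mono) auto
  also have "\<dots> = ennreal (16 * ((M r * r powr (\<alpha> - 1)) * (r / 2)))"
    by (simp add: algebra_simps)
  also have "\<dots> = 16 * (ennreal (M r * r powr (\<alpha> - 1)) * ennreal (r / 2))"
    using nonneg[OF \<open>r > 0\<close>] \<open>r > 0\<close> by (subst ennreal_mult, simp, simp, subst ennreal_mult) auto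
  also have "ennreal (M r * r powr (\<alpha> - 1)) * ennreal (r / 2)
      = (\<integral>\<^sup>+ t. ennreal (M r * r powr (\<alpha> - 1)) * indicator {r / 2<..r} t \<partial>lborel)"
    using \<open>r > 0\<close> by (simp add: nn_integral_cmult_indicator)
  also have "\<dots> \<le> (\<integral>\<^sup>+ t\<in>{r / 2<..r}. ?w t \<partial>lborel)"
  proof (rule nn_integral_mono)
    fix t
    \<comment> \<open>Both factors are nonincreasing, the power because
      \<open>\<alpha> \<le> 1\<close>, so the integrand is smallest at the right end.\<close>
    have "M r * r powr (\<alpha> - 1) \<le> M t * t powr (\<alpha> - 1)" if "r / 2 < t" "t \<le> r"
      using that nonneg anti \<alpha> \<open>r > 0\<close> by (intro mult_mono powr_mono2') auto
    then show "ennreal (M r * r powr (\<alpha> - 1)) * indicator {r / 2<..r} t \<le> ?w t * indicator {r / 2<..r} t"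
      by (auto simp: indicator_def intro!: ennreal_leI)
  qed
  finally have "ennreal (M r * (8 * r) powr \<alpha>) \<le> 16 * (\<integral>\<^sup>+ t\<in>{r / 2<..r}. ?w t \<partial>lborel)"
    by (simp add: mult_left_mono)
  moreover have "(\<integral>\<^sup>+ t\<in>{0<..r / 2} \<union> {r / 2<..r}. ?w t \<partial>lborel)
      = (\<integral>\<^sup>+ t\<in>{0<..r / 2}. ?w t \<partial>lborel) + (\<integral>\<^sup>+ t\<in>{r / 2<..r}. ?w t \<partial>lborel)"
    by (rule nn_integral_disjoint_pair) auto
  moreover have "{0<..r / 2} \<union> {r / 2<..r} = {0<..r}"
    using \<open>r > 0\<close> by auto
  ultimately show ?thesis
    by (simp add: distrib_left add.commute[of _ "16 * (\<integral>\<^sup>+ t\<in>{0<..r / 2}. ?w t \<partial>lborel)"] add_left_mono)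
qed

subsection \<open>Descent along good rows and columns\<close>

text \<open>Rows and columns that miss \<open>Z'\<close> on a set of positive measure are discarded.
  Almost all rows and columns survive, so a section through a retained point loses only a further
  null set. The descent needs this at every point it visits.\<close>

lemma AE_full_core:
  fixes Z' :: "('a::euclidean_space \<times> 'b::euclidean_space) set"
  assumes "Z' \<in> sets borel" and ae: "AE z in lborel. z \<in> Z'"
  obtains Z where "Z \<subseteq> Z'" "AE z in lborel. z \<in> Z"
    "\<And>x y. (x, y) \<in> Z \<Longrightarrow> AE y' in lborel. (x, y') \<in> Z"
    "\<And>x y. (x, y) \<in> Z \<Longrightarrow> AE x' in lborel. (x', y) \<in> Z"
proof -
  have [measurable]: "Z' \<in> sets (borel \<Otimes>\<^sub>M borel)"
    unfolding borel_prod by (rule assms(1))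
  define X where "X x \<longleftrightarrow> (AE y in lborel. (x, y) \<in> Z')" for x
  define Y where "Y y \<longleftrightarrow> (AE x in lborel. (x, y) \<in> Z')" for y
  have [measurable]: "Measurable.pred borel X"
    unfolding X_def by (intro pred_AE_lborel) simp
  have [measurable]: "Measurable.pred borel Y"
    unfolding Y_def by (intro pred_AE_lborel) measurable
  have X: "AE x in lborel. X x" and Y: "AE y in lborel. Y y"
    using AE_lebesgue_sections[of "\<lambda>z. z \<in> Z'"] ae by (auto simp: X_def Y_def AE_lebesgue_iff)
  let ?Z = "{z \<in> Z'. X (fst z) \<and> Y (snd z)}"
  show thesis
  proof
    have "AE z in lborel. X (fst (z :: 'a \<times> 'b)) \<and> Y (snd z)"
      by (subst AE_lborel_prod_iff) (measurable, use X in \<open>eventually_elim, use Y in simp\<close>)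
    with ae show "AE z in lborel. z \<in> ?Z"
      by eventually_elim auto
    show "AE y' in lborel. (x, y') \<in> ?Z" if "(x, y) \<in> ?Z" for x y
    proof -
      have "AE y' in lborel. (x, y') \<in> Z'" "X x"
        using that by (auto simp: X_def)
      with Y show ?thesis by (auto elim!: eventually_elim2)
    qed
    show "AE x' in lborel. (x', y) \<in> ?Z" if "(x, y) \<in> ?Z" for x y
    proof -
      have "AE x' in lborel. (x', y) \<in> Z'" "Y y"
        using that by (auto simp: Y_def)
      with X show ?thesis by (auto elim!: eventually_elim2)
    qed
  qed auto
qed

text \<open>Otherwise the interval, of measure \<open>l\<close>, would lie up to a null set in a
  superlevel set of measure at most \<open>s < l\<close>.\<close>

lemma AE_exists_sublevel:
  fixes \<phi> :: "real \<Rightarrow> real"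
  assumes ae: "AE x in lborel. P x" and [measurable]: "\<phi> \<in> borel_measurable borel"
    and level: "emeasure lborel {x. m < \<phi> x} \<le> ennreal s" and "0 \<le> s" "s < l"
  shows "\<exists>x\<in>{a..a + l}. P x \<and> \<phi> x \<le> m"
proof (rule ccontr)
  assume contr: "\<not> ?thesis"
  have "ennreal l = emeasure lborel {a..a + l}"
    using assms by simp
  also have "\<dots> \<le> emeasure lborel {x \<in> space lborel. m < \<phi> x}"
    using ae contr by (intro emeasure_mono_AE) (auto elim!: eventually_mono simp: not_le)
  also have "\<dots> \<le> ennreal s" using level by simp
  finally show False using assms by (simp add: ennreal_le_iff)
qed

text \<open>Collects what the descent uses: a single nonincreasing \<open>M\<close> controlling the
  level sets of both Hoelder constants, and a set \<open>Z\<close> on which the Hoelder bounds are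
  exact and whose sections have full measure.\<close>

locale grid_descent =
  fixes g :: "real \<times> real \<Rightarrow> real" and \<phi>1 \<phi>2 M :: "real \<Rightarrow> real" and \<alpha> :: real and Z :: "(real \<times> real) set"
  assumes \<alpha>: "0 < \<alpha>" "\<alpha> \<le> 1"
    and M_measurable [measurable]: "M \<in> borel_measurable borel"
    and M_nonneg: "t > 0 \<Longrightarrow> 0 \<le> M t"
    and M_anti: "0 < s \<Longrightarrow> s \<le> t \<Longrightarrow> M t \<le> M s"
    and \<phi>_measurable [measurable]: "\<phi>1 \<in> borel_measurable borel" "\<phi>2 \<in> borel_measurable borel"
    and level1: "t > 0 \<Longrightarrow> emeasure lborel {y. M t < \<phi>1 y} \<le> ennreal t"
    and level2: "t > 0 \<Longrightarrow> emeasure lborel {x. M t < \<phi>2 x} \<le> ennreal t"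
    and row: "(x, y) \<in> Z \<Longrightarrow> (x', y) \<in> Z \<Longrightarrow> \<bar>g (x, y) - g (x', y)\<bar> \<le> \<phi>1 y * \<bar>x - x'\<bar> powr \<alpha>"
    and col: "(x, y) \<in> Z \<Longrightarrow> (x, y') \<in> Z \<Longrightarrow> \<bar>g (x, y) - g (x, y')\<bar> \<le> \<phi>2 x * \<bar>y - y'\<bar> powr \<alpha>"
    and sect_row: "(x, y) \<in> Z \<Longrightarrow> AE x' in lborel. (x', y) \<in> Z"
    and sect_col: "(x, y) \<in> Z \<Longrightarrow> AE y' in lborel. (x, y') \<in> Z"
begin

text \<open>Up to a factor, the bound for the modulus of continuity. Values in
  \<open>ennreal\<close> let the descent run before the integral is known to be finite.\<close>

definition W :: "real \<Rightarrow> ennreal" where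
  "W r = (\<integral>\<^sup>+ t\<in>{0<..r}. ennreal (M t * t powr (\<alpha> - 1)) \<partial>lborel)"

lemma W_mono: "r \<le> s \<Longrightarrow> W r \<le> W s"
  unfolding W_def by (intro nn_integral_mono) (auto simp: indicator_def)

lemma W_step: "r > 0 \<Longrightarrow> ennreal (M r * (8 * r) powr \<alpha>) + 16 * W (r / 2) \<le> 16 * W r"
  unfolding W_def by (rule dyadic_integral_bound) (auto simp: M_nonneg M_anti \<alpha>)

text \<open>
  The grid points of scale \<open>\<rho>\<close>. The condition \<open>(x, snd z) \<in> Z\<close> makes the last jump possible,
  from \<open>(x, y)\<close> along the column to \<open>(x, snd z)\<close> and then along the row to \<open>z\<close>.
\<close>

definition near :: "real \<times> real \<Rightarrow> real \<Rightarrow> real \<Rightarrow> real \<Rightarrow> bool" where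
  "near z \<rho> x y \<longleftrightarrow> \<bar>x - fst z\<bar> \<le> \<rho> \<and> \<bar>y - snd z\<bar> \<le> \<rho> \<and> (x, y) \<in> Z \<and> (x, snd z) \<in> Z \<and>
     \<phi>1 y \<le> M (\<rho> / 2) \<and> \<phi>2 x \<le> M (\<rho> / 2)"

text \<open>The cost of one move, brought to the form that \<open>W_step\<close> absorbs: a row or
  column chosen at a coarser scale \<open>s\<close> is still good at scale \<open>r\<close>, as
  \<open>M\<close> is nonincreasing.\<close>

lemma osc_term_le:
  assumes "\<phi> \<le> M s" "r \<le> s" "0 < r" "0 \<le> d" "d \<le> 8 * r"
  shows "\<phi> * d powr \<alpha> \<le> M r * (8 * r) powr \<alpha>"
  using assms \<alpha> M_anti[of r s] M_nonneg[of r] by (intro mult_mono powr_mono2) auto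

text \<open>First move along the old row \<open>y\<close> to a new good column \<open>x'\<close>,
  then along that column to a new good row \<open>y'\<close>. Two moves double the 16 of
  \<open>W_step\<close> to 32.\<close>

lemma descent_step:
  assumes z: "z \<in> Z" and near: "near z \<rho> x y" and "\<rho> > 0"
  shows "\<exists>x' y'. near z (\<rho> / 2) x' y' \<and>
    ennreal \<bar>g (x, y) - g (x', y')\<bar> + 32 * W (\<rho> / 8) \<le> 32 * W (\<rho> / 4)"
proof -
  \<comment> \<open>The new column must meet \<open>Z\<close> on row \<open>y\<close>, for the
    horizontal move, and on the row of \<open>z\<close>, to preserve \<open>near\<close>.\<close>
  have "AE x' in lborel. (x', y) \<in> Z \<and> (x', snd z) \<in> Z"
    using sect_row[of x y] sect_row[of "fst z" "snd z"] z near by (auto simp: near_def)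
  \<comment> \<open>The interval has length \<rho> and is centred at \<open>fst z\<close>, while the
    bad columns have measure at most \<open>\<rho> / 4\<close>.\<close>
  from AE_exists_sublevel[OF this \<phi>_measurable(2) level2[of "\<rho> / 4"], of \<rho> "fst z - \<rho> / 2"] \<open>\<rho> > 0\<close>
  obtain x' where "x' \<in> {fst z - \<rho> / 2..fst z - \<rho> / 2 + \<rho>}"
    and x': "(x', y) \<in> Z" "(x', snd z) \<in> Z" "\<phi>2 x' \<le> M (\<rho> / 4)"
    by auto
  then have x'_dist: "\<bar>x' - fst z\<bar> \<le> \<rho> / 2" unfolding atLeastAtMost_iff by arith
  from AE_exists_sublevel[OF sect_col[OF x'(1)] \<phi>_measurable(1) level1[of "\<rho> / 4"], of \<rho> "snd z - \<rho> / 2"] \<open>\<rho> > 0\<close>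
  obtain y' where "y' \<in> {snd z - \<rho> / 2..snd z - \<rho> / 2 + \<rho>}"
    and y': "(x', y') \<in> Z" "\<phi>1 y' \<le> M (\<rho> / 4)"
    by auto
  then have y'_dist: "\<bar>y' - snd z\<bar> \<le> \<rho> / 2" unfolding atLeastAtMost_iff by arith
  \<comment> \<open>The old point is within \<rho> of \<open>z\<close> and the new one within
    \<open>\<rho> / 2\<close>; the bound \<open>2 * \<rho>\<close> equals
    \<open>8 * (\<rho> / 4)\<close>.\<close>
  have d: "\<bar>x - x'\<bar> \<le> 2 * \<rho>" "\<bar>y - y'\<bar> \<le> 2 * \<rho>"
    using near x'_dist y'_dist unfolding near_def by linarith+
  let ?T = "M (\<rho> / 4) * (8 * (\<rho> / 4)) powr \<alpha>"
  have "\<bar>g (x, y) - g (x', y)\<bar> \<le> \<phi>1 y * \<bar>x - x'\<bar> powr \<alpha>"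
    using near x' by (intro row) (auto simp: near_def)
  \<comment> \<open>Row \<open>y\<close> was chosen at the previous scale, hence the level
    \<open>M (\<rho> / 2)\<close>.\<close>
  also have "\<dots> \<le> ?T"
    using near d \<open>\<rho> > 0\<close> by (intro osc_term_le[of _ "\<rho> / 2"]) (auto simp: near_def)
  finally have "\<bar>g (x, y) - g (x', y)\<bar> \<le> ?T" .
  moreover have "\<bar>g (x', y) - g (x', y')\<bar> \<le> \<phi>2 x' * \<bar>y - y'\<bar> powr \<alpha>"
    using x' y' by (intro col) auto
  moreover have "\<phi>2 x' * \<bar>y - y'\<bar> powr \<alpha> \<le> ?T"
    using x' d \<open>\<rho> > 0\<close> by (intro osc_term_le[of _ "\<rho> / 4"]) (auto simp: near_def)
  ultimately have "\<bar>g (x, y) - g (x', y')\<bar> \<le> 2 * ?T"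
    by linarith
  then have "ennreal \<bar>g (x, y) - g (x', y')\<bar> \<le> ennreal (2 * ?T)"
    by (rule ennreal_leI)
  also have "\<dots> = 2 * ennreal ?T"
    using M_nonneg[of "\<rho> / 4"] \<open>\<rho> > 0\<close> by (subst ennreal_mult) auto
  finally have "ennreal \<bar>g (x, y) - g (x', y')\<bar> + 32 * W (\<rho> / 4 / 2) \<le> 2 * ennreal ?T + 32 * W (\<rho> / 4 / 2)"
    by (rule add_right_mono)
  also have "\<dots> = 2 * (ennreal ?T + 16 * W (\<rho> / 4 / 2))"
    by (simp add: distrib_left mult.assoc[symmetric])
  also have "\<dots> \<le> 2 * (16 * W (\<rho> / 4))"
    using \<open>\<rho> > 0\<close> by (intro mult_left_mono W_step) auto
  finally have "ennreal \<bar>g (x, y) - g (x', y')\<bar> + 32 * W (\<rho> / 8) \<le> 32 * W (\<rho> / 4)"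
    by (simp add: mult.assoc[symmetric])
  moreover have "near z (\<rho> / 2) x' y'"
    using x' y' x'_dist y'_dist by (simp add: near_def)
  ultimately show ?thesis by blast
qed

text \<open>The costs telescope: the multiple of \<open>W\<close> left over after \<open>n\<close>
  steps pays for the next one, so the bound does not depend on \<open>n\<close>.\<close>

lemma descent:
  assumes z: "z \<in> Z" and near: "near z \<rho> x y" and "\<rho> > 0"
  shows "\<exists>x' y'. near z (\<rho> / 2 ^ n) x' y' \<and>
    ennreal \<bar>g (x, y) - g (x', y')\<bar> + 32 * W (\<rho> / 2 ^ n / 4) \<le> 32 * W (\<rho> / 4)"
proof (induction n)
  case 0
  show ?case using near by (intro exI[of _ x] exI[of _ y]) simp
next
  case (Suc n)
  then obtain x' y' where near': "near z (\<rho> / 2 ^ n) x' y'"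
    and IH: "ennreal \<bar>g (x, y) - g (x', y')\<bar> + 32 * W (\<rho> / 2 ^ n / 4) \<le> 32 * W (\<rho> / 4)"
    by blast
  obtain x'' y'' where near'': "near z (\<rho> / 2 ^ n / 2) x'' y''"
    and step: "ennreal \<bar>g (x', y') - g (x'', y'')\<bar> + 32 * W (\<rho> / 2 ^ n / 8) \<le> 32 * W (\<rho> / 2 ^ n / 4)"
    using descent_step[OF z near'] \<open>\<rho> > 0\<close> by auto
  have "ennreal \<bar>g (x, y) - g (x'', y'')\<bar> \<le> ennreal (\<bar>g (x, y) - g (x', y')\<bar> + \<bar>g (x', y') - g (x'', y'')\<bar>)"
    by (intro ennreal_leI) linarith
  also have "\<dots> = ennreal \<bar>g (x, y) - g (x', y')\<bar> + ennreal \<bar>g (x', y') - g (x'', y'')\<bar>"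
    by simp
  finally have "ennreal \<bar>g (x, y) - g (x'', y'')\<bar> + 32 * W (\<rho> / 2 ^ n / 8)
      \<le> ennreal \<bar>g (x, y) - g (x', y')\<bar> + (ennreal \<bar>g (x', y') - g (x'', y'')\<bar> + 32 * W (\<rho> / 2 ^ n / 8))"
    by (simp add: add.assoc[symmetric] add_right_mono)
  also have "\<dots> \<le> ennreal \<bar>g (x, y) - g (x', y')\<bar> + 32 * W (\<rho> / 2 ^ n / 4)"
    using step by (rule add_left_mono)
  also note IH
  finally have "ennreal \<bar>g (x, y) - g (x'', y'')\<bar> + 32 * W (\<rho> / 2 ^ n / 8) \<le> 32 * W (\<rho> / 4)" .
  with near'' show ?case
    by (intro exI[of _ x''] exI[of _ y'']) (simp add: field_simps)
qed

text \<open>As \<open>g\<close> is not yet known to be continuous, approaching \<open>z\<close> does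
  not suffice, and a last jump through \<open>(x', snd z)\<close> reaches it exactly. Its column
  part costs at most \<open>16 * W \<rho>\<close>, which with the 32 of \<open>descent\<close> gives
  48; its row part vanishes as \<open>n\<close> grows.\<close>

lemma descent_limit:
  assumes z: "z \<in> Z" and near: "near z \<rho> x y" and "\<rho> > 0"
  shows "ennreal \<bar>g (x, y) - g z\<bar> \<le> 48 * W \<rho>"
proof -
  have "ennreal \<bar>g (x, y) - g z\<bar> \<le> 48 * W \<rho> + ennreal (\<bar>\<phi>1 (snd z)\<bar> * (\<rho> / 2 ^ n) powr \<alpha>)" for n
  proof -
    define r where "r = \<rho> / 2 ^ n"
    obtain x' y' where near': "near z r x' y'"
      and le: "ennreal \<bar>g (x, y) - g (x', y')\<bar> + 32 * W (r / 4) \<le> 32 * W (\<rho> / 4)"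
      using descent[OF assms] unfolding r_def by blast
    have r: "0 < r" "r \<le> \<rho>"
      using \<open>\<rho> > 0\<close> by (auto simp: r_def field_simps)
    have "\<bar>g (x', y') - g (x', snd z)\<bar> \<le> \<phi>2 x' * \<bar>y' - snd z\<bar> powr \<alpha>"
      using near' by (intro col) (auto simp: near_def)
    also have "\<dots> \<le> M (r / 2) * (8 * (r / 2)) powr \<alpha>"
      using near' r by (intro osc_term_le[of _ "r / 2"]) (auto simp: near_def)
    finally have 1: "\<bar>g (x', y') - g (x', snd z)\<bar> \<le> M (r / 2) * (8 * (r / 2)) powr \<alpha>" .
    have "ennreal (M (r / 2) * (8 * (r / 2)) powr \<alpha>) \<le> 16 * W (r / 2)"
      using W_step[of "r / 2"] r by (meson add_increasing2 half_gt_zero order_trans order_refl le_add_same_cancel1 zero_le ennreal_0)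
    also have "\<dots> \<le> 16 * W \<rho>"
      using r by (intro mult_left_mono W_mono) auto
    finally have last_le: "ennreal (M (r / 2) * (8 * (r / 2)) powr \<alpha>) \<le> 16 * W \<rho>" .
    \<comment> \<open>The row of \<open>z\<close> need not be good at any scale, but its constant is
      fixed while \<open>r\<close> tends to 0.\<close>
    have "\<bar>g (x', snd z) - g (fst z, snd z)\<bar> \<le> \<phi>1 (snd z) * \<bar>x' - fst z\<bar> powr \<alpha>"
      using near' z by (intro row) (auto simp: near_def)
    also have "\<dots> \<le> \<bar>\<phi>1 (snd z)\<bar> * r powr \<alpha>"
      using near' \<alpha> by (intro mult_mono powr_mono2) (auto simp: near_def)
    finally have 2: "\<bar>g (x', snd z) - g z\<bar> \<le> \<bar>\<phi>1 (snd z)\<bar> * r powr \<alpha>" by simp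
    have "ennreal \<bar>g (x, y) - g (x', y')\<bar> \<le> 32 * W (\<rho> / 4)"
      using le by (meson add_increasing2 order_trans order_refl zero_le)
    also have "\<dots> \<le> 32 * W \<rho>"
      using \<open>\<rho> > 0\<close> by (intro mult_left_mono W_mono) auto
    finally have head_le: "ennreal \<bar>g (x, y) - g (x', y')\<bar> \<le> 32 * W \<rho>" .
    have "\<bar>g (x, y) - g z\<bar> \<le> \<bar>g (x, y) - g (x', y')\<bar> + M (r / 2) * (8 * (r / 2)) powr \<alpha> + \<bar>\<phi>1 (snd z)\<bar> * r powr \<alpha>"
      using 1 2 by linarith
    then have "ennreal \<bar>g (x, y) - g z\<bar> \<le> ennreal (\<bar>g (x, y) - g (x', y')\<bar> + M (r / 2) * (8 * (r / 2)) powr \<alpha> + \<bar>\<phi>1 (snd z)\<bar> * r powr \<alpha>)"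
      by (rule ennreal_leI)
    also have "\<dots> = ennreal \<bar>g (x, y) - g (x', y')\<bar> + ennreal (M (r / 2) * (8 * (r / 2)) powr \<alpha>) + ennreal (\<bar>\<phi>1 (snd z)\<bar> * r powr \<alpha>)"
      using M_nonneg[of "r / 2"] r by (simp add: ennreal_plus)
    also have "\<dots> \<le> 32 * W \<rho> + 16 * W \<rho> + ennreal (\<bar>\<phi>1 (snd z)\<bar> * r powr \<alpha>)"
      using head_le last_le by (intro add_mono) auto
    also have "\<dots> = 48 * W \<rho> + ennreal (\<bar>\<phi>1 (snd z)\<bar> * r powr \<alpha>)"
      by (simp add: distrib_right[symmetric])
    finally show ?thesis by (simp add: r_def)
  qed
  moreover have "(\<lambda>n. 48 * W \<rho> + ennreal (\<bar>\<phi>1 (snd z)\<bar> * (\<rho> / 2 ^ n) powr \<alpha>)) \<longlonglongrightarrow> 48 * W \<rho> + ennreal (\<bar>\<phi>1 (snd z)\<bar> * 0 powr \<alpha>)"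
  proof (intro tendsto_intros tendsto_powr')
    show "(\<lambda>n. \<rho> / 2 ^ n) \<longlonglongrightarrow> 0"
      by (rule LIMSEQ_divide_realpow_zero) simp
  qed (use \<alpha> \<open>\<rho> > 0\<close> in auto)
  ultimately show ?thesis
    using \<alpha> by (intro LIMSEQ_le_const) auto
qed

text \<open>Both points descend from one common grid point of scale \<delta>, which doubles 48 to
  96.\<close>

lemma oscillation_le:
  assumes z: "z1 \<in> Z" "z2 \<in> Z" and "\<delta> > 0"
    and dist: "\<bar>fst z1 - fst z2\<bar> \<le> \<delta>" "\<bar>snd z1 - snd z2\<bar> \<le> \<delta>"
  shows "ennreal \<bar>g z1 - g z2\<bar> \<le> 96 * W \<delta>"
proof -
  have "AE x in lborel. (x, snd z1) \<in> Z \<and> (x, snd z2) \<in> Z"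
    using sect_row[of "fst z1" "snd z1"] sect_row[of "fst z2" "snd z2"] z by auto
  from AE_exists_sublevel[OF this \<phi>_measurable(2) level2[of "\<delta> / 2"], of \<delta> "min (fst z1) (fst z2)"] \<open>\<delta> > 0\<close>
  obtain x where x: "x \<in> {min (fst z1) (fst z2)..min (fst z1) (fst z2) + \<delta>}"
      "(x, snd z1) \<in> Z" "(x, snd z2) \<in> Z" "\<phi>2 x \<le> M (\<delta> / 2)"
    by auto
  from AE_exists_sublevel[OF sect_col[OF x(2)] \<phi>_measurable(1) level1[of "\<delta> / 2"], of \<delta> "min (snd z1) (snd z2)"] \<open>\<delta> > 0\<close>
  obtain y where y: "y \<in> {min (snd z1) (snd z2)..min (snd z1) (snd z2) + \<delta>}" "(x, y) \<in> Z" "\<phi>1 y \<le> M (\<delta> / 2)"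
    by auto
  have "near z1 \<delta> x y" "near z2 \<delta> x y"
    using x y dist by (auto simp: near_def min_def abs_le_iff split: if_splits)
  then have le: "ennreal \<bar>g (x, y) - g z1\<bar> \<le> 48 * W \<delta>" "ennreal \<bar>g (x, y) - g z2\<bar> \<le> 48 * W \<delta>"
    using descent_limit z \<open>\<delta> > 0\<close> by auto
  have "ennreal \<bar>g z1 - g z2\<bar> \<le> ennreal (\<bar>g (x, y) - g z1\<bar> + \<bar>g (x, y) - g z2\<bar>)"
    by (intro ennreal_leI) linarith
  also have "\<dots> = ennreal \<bar>g (x, y) - g z1\<bar> + ennreal \<bar>g (x, y) - g z2\<bar>"
    by simp
  also have "\<dots> \<le> 48 * W \<delta> + 48 * W \<delta>"
    using le by (rule add_mono)
  also have "\<dots> = 96 * W \<delta>"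
    by (simp add: distrib_right[symmetric])
  finally show ?thesis .
qed

end

subsection \<open>Continuous extension\<close>

lemma modulus_extension:
  fixes g :: "real \<times> real \<Rightarrow> real" and V :: "real \<Rightarrow> ennreal"
  assumes Z: "AE z in lborel. z \<in> Z"
    and osc: "\<And>z1 z2 \<delta>. z1 \<in> Z \<Longrightarrow> z2 \<in> Z \<Longrightarrow> \<delta> > 0 \<Longrightarrow> \<bar>fst z1 - fst z2\<bar> \<le> \<delta> \<Longrightarrow> \<bar>snd z1 - snd z2\<bar> \<le> \<delta> \<Longrightarrow>
      ennreal \<bar>g z1 - g z2\<bar> \<le> V \<delta>"
    and V0: "(\<lambda>n. V (1 / real (Suc n))) \<longlonglongrightarrow> 0"
    and bdd: "\<And>z. z \<in> Z \<Longrightarrow> \<bar>g z\<bar> \<le> K"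
  shows "\<exists>G. bounded (range G) \<and> uniformly_continuous_on UNIV G \<and> (\<forall>z\<in>Z. G z = g z) \<and>
    (\<forall>\<delta>>0. ennreal (omega G \<delta>) \<le> V \<delta>)"
proof -
  have dense: "closure Z = UNIV"
  proof -
    have "AE z in lebesgue. z \<in> closure Z"
      unfolding AE_lebesgue_iff using Z by eventually_elim (use closure_subset in auto)
    then show ?thesis
      using mem_closed_if_AE_lebesgue[OF closed_closure] by blast
  qed
  have "uniformly_continuous_on Z g"
    unfolding uniformly_continuous_on_def
  proof safe
    fix e :: real assume "e > 0"
    then have "\<forall>\<^sub>F n in sequentially. V (1 / real (Suc n)) < ennreal e"
      using V0 by (intro order_tendstoD) auto
    then obtain n where n: "V (1 / real (Suc n)) < ennreal e"
      by (auto simp: eventually_sequentially)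
    show "\<exists>d>0. \<forall>x\<in>Z. \<forall>x'\<in>Z. dist x' x < d \<longrightarrow> dist (g x') (g x) < e"
    proof (intro exI[of _ "1 / real (Suc n)"] conjI ballI impI)
      fix x x' assume x: "x \<in> Z" "x' \<in> Z" "dist x' x < 1 / real (Suc n)"
      have "\<bar>fst x' - fst x\<bar> \<le> 1 / real (Suc n)" "\<bar>snd x' - snd x\<bar> \<le> 1 / real (Suc n)"
        using dist_fst_le[of x' x] dist_snd_le[of x' x] x(3) by (auto simp: dist_real_def)
      then have "ennreal \<bar>g x' - g x\<bar> < ennreal e"
        using osc[OF x(2,1), of "1 / real (Suc n)"] n by (auto intro: order.strict_trans1)
      then show "dist (g x') (g x) < e"
        by (simp add: dist_real_def ennreal_less_iff)
    qed auto
  qed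
  then obtain G where G: "uniformly_continuous_on (closure Z) G" "\<And>z. z \<in> Z \<Longrightarrow> g z = G z"
    by (rule uniformly_continuous_on_extension_on_closure) (erule that, simp)
  then have unif: "uniformly_continuous_on UNIV G"
    by (simp add: dense)
  then have cont: "continuous_on UNIV G"
    by (rule uniformly_continuous_imp_continuous)
  show ?thesis
  proof (intro exI[of _ G] conjI ballI allI impI)
    have "closed {z. \<bar>G z\<bar> \<le> K}"
      by (intro closed_Collect_le continuous_intros cont)
    moreover have "Z \<subseteq> {z. \<bar>G z\<bar> \<le> K}"
      using bdd G(2) by auto
    ultimately have "closure Z \<subseteq> {z. \<bar>G z\<bar> \<le> K}"
      by (intro closure_minimal)
    then show "bounded (range G)"
      unfolding dense bounded_iff by (intro exI[of _ K]) auto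
    fix \<delta> :: real assume "\<delta> > 0"
    show "ennreal (omega G \<delta>) \<le> V \<delta>"
    proof (cases "V \<delta>")
      case (real v)
      have le: "\<bar>G (fst z + h, snd z + k) - G z\<bar> \<le> v" if hk: "h \<in> {0..\<delta>}" "k \<in> {0..\<delta>}" for z h k
      proof -
        have "closed {z. \<bar>G ((h, k) + z) - G z\<bar> \<le> v}"
          by (intro closed_Collect_le continuous_intros continuous_on_compose2[OF cont]) auto
        moreover have "AE z in lebesgue. z \<in> {z. \<bar>G ((h, k) + z) - G z\<bar> \<le> v}"
          unfolding AE_lebesgue_iff using Z AE_lborel_shift[OF Z, of "(h, k)"]
        proof eventually_elim
          case (elim z)
          have "ennreal \<bar>g ((h, k) + z) - g z\<bar> \<le> V \<delta>"
            using elim hk \<open>\<delta> > 0\<close> by (intro osc) auto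
          then show ?case
            using elim real by (simp add: G(2))
        qed
        ultimately have "z \<in> {z. \<bar>G ((h, k) + z) - G z\<bar> \<le> v}"
          by (rule mem_closed_if_AE_lebesgue)
        then show ?thesis
          by (cases z) (simp add: add.commute)
      qed
      have "omega G \<delta> \<le> v"
        unfolding omega_def using le \<open>\<delta> > 0\<close> by (intro cSUP_least) auto
      then show ?thesis
        using real by (simp add: ennreal_leI)
    qed simp
  qed (use unif G(2) in auto)
qed

subsection \<open>Sections and full-measure sets\<close>

lemma lip_sections_borel_version:
  fixes k :: "real \<Rightarrow> real \<Rightarrow> real" and h :: "real \<times> real \<Rightarrow> real"
  assumes "\<alpha> > 0" and h [measurable]: "h \<in> borel_measurable borel"
    and eq: "AE y in lborel. AE x in lborel. k y x = h (y, x)"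
    and lip: "AE y in lborel. in_Lip \<alpha> (k y)"
  defines "\<phi> \<equiv> \<lambda>y. real_of_ereal (lip_semi \<alpha> (\<lambda>x. h (y, x)))"
  shows "\<phi> \<in> borel_measurable borel"
    and "AE y in lborel. real_of_ereal (lip_semi \<alpha> (k y)) = \<phi> y"
    and "AE y in lborel. ae_holder \<alpha> (\<phi> y) (\<lambda>x. h (y, x))"
    and "AE y in lborel. 0 \<le> \<phi> y \<and> \<phi> y \<le> lip_norm \<alpha> (k y)"
    and "AE y in lborel. AE x in lborel. \<bar>h (y, x)\<bar> \<le> lip_norm \<alpha> (k y)"
proof -
  have h' [measurable]: "h \<in> borel_measurable (borel \<Otimes>\<^sub>M borel)"
    unfolding borel_prod by (rule h)
  show "\<phi> \<in> borel_measurable borel"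
    unfolding \<phi>_def by (rule borel_measurable_lip_semi[OF \<open>\<alpha> > 0\<close> h'])
  have sect: "(\<lambda>x. h (y, x)) \<in> borel_measurable borel" for y
    by measurable
  have main: "AE y in lborel. lip_semi \<alpha> (k y) = ereal (\<phi> y) \<and> lip_semi \<alpha> (\<lambda>x. h (y, x)) = ereal (\<phi> y) \<and>
      0 \<le> \<phi> y \<and> \<phi> y \<le> lip_norm \<alpha> (k y) \<and> ess_norm (k y) \<le> ereal (lip_norm \<alpha> (k y))"
    using eq lip
  proof eventually_elim
    case (elim y)
    have *: "lip_semi \<alpha> (k y) = lip_semi \<alpha> (\<lambda>x. h (y, x))"
      using elim(1) by (intro lip_semi_cong) (simp add: AE_lebesgue_iff)
    obtain a where a: "lip_semi \<alpha> (k y) = ereal a" "0 \<le> a"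
      using elim(2) lip_semi_nonneg[of \<alpha> "k y"] by (cases "lip_semi \<alpha> (k y)") (auto simp: in_Lip_def)
    obtain b where b: "ess_norm (k y) = ereal b" "0 \<le> b"
      using elim(2) ess_norm_nonneg[of "k y"] by (cases "ess_norm (k y)") (auto simp: in_Lip_def)
    show ?case
      using a b * by (auto simp: lip_norm_def \<phi>_def)
  qed
  show "AE y in lborel. real_of_ereal (lip_semi \<alpha> (k y)) = \<phi> y"
    using main by eventually_elim simp
  show "AE y in lborel. 0 \<le> \<phi> y \<and> \<phi> y \<le> lip_norm \<alpha> (k y)"
    using main by eventually_elim simp
  show "AE y in lborel. ae_holder \<alpha> (\<phi> y) (\<lambda>x. h (y, x))"
    using main by eventually_elim (simp add: lip_semi_le_iff_ae_holder[OF \<open>\<alpha> > 0\<close> sect, symmetric])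
  show "AE y in lborel. AE x in lborel. \<bar>h (y, x)\<bar> \<le> lip_norm \<alpha> (k y)"
    using main eq
  proof eventually_elim
    case (elim y)
    then have "AE x in lborel. ereal \<bar>k y x\<bar> \<le> ereal (lip_norm \<alpha> (k y))"
      by (simp add: ess_norm_le_iff AE_lebesgue_iff)
    with elim(2) show ?case
      by eventually_elim simp
  qed
qed

lemma lborel_level_lebesgue:
  assumes [measurable]: "f \<in> borel_measurable borel"
  shows "emeasure lebesgue {x. s < \<bar>f x :: real\<bar>} = emeasure lborel {x. s < \<bar>f x\<bar>}"
proof -
  have "{x \<in> space borel. s < \<bar>f x\<bar>} \<in> sets borel" by measurable
  then show ?thesis by simp
qed

lemma S0_of_section_bounds:
  fixes g :: "'a::euclidean_space \<times> 'b::euclidean_space \<Rightarrow> real"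
  assumes g [measurable]: "g \<in> borel_measurable borel" and S0: "S0 \<psi>1" "S0 \<psi>2"
    and le1: "AE y in lborel. AE x in lborel. \<bar>g (x, y)\<bar> \<le> \<psi>1 y"
    and le2: "AE x in lborel. AE y in lborel. \<bar>g (x, y)\<bar> \<le> \<psi>2 x"
  shows "S0 g"
  unfolding S0_def
proof safe
  show "g \<in> borel_measurable lebesgue"
    using g by (intro measurable_completion) simp
  have g' [measurable]: "g \<in> borel_measurable (borel \<Otimes>\<^sub>M borel)"
    unfolding borel_prod by (rule g)
  have borel_version: "\<exists>\<psi>'\<in>borel_measurable borel. (AE y in lborel. \<psi> y = \<psi>' y) \<and>
      (\<forall>s>0. emeasure lborel {y. s < \<bar>\<psi>' y :: real\<bar>} < \<infinity>)" if "S0 \<psi>" for \<psi> :: "'c::euclidean_space \<Rightarrow> real"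
  proof -
    have "\<psi> \<in> borel_measurable lebesgue"
      using that by (simp add: S0_def)
    then obtain \<psi>' where \<psi>': "\<psi>' \<in> borel_measurable borel" "AE y in lborel. \<psi> y = \<psi>' y"
      using completion_ex_borel_measurable_real[of \<psi> lborel] by auto
    then have "\<psi>' \<in> borel_measurable lebesgue"
      by (intro measurable_completion) simp
    then have "S0 \<psi>'"
      using \<psi>'(2) that by (intro S0_mono[of \<psi> \<psi>']) (auto simp: AE_lebesgue_iff elim!: eventually_mono)
    then show ?thesis
      using \<psi>' by (auto simp: S0_def lborel_level_lebesgue)
  qed
  obtain \<psi>1' where \<psi>1': "\<psi>1' \<in> borel_measurable borel" "AE y in lborel. \<psi>1 y = \<psi>1' y"
      "\<And>s. s > 0 \<Longrightarrow> emeasure lborel {y. s < \<bar>\<psi>1' y\<bar>} < \<infinity>"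
    using borel_version[OF S0(1)] by blast
  obtain \<psi>2' where \<psi>2': "\<psi>2' \<in> borel_measurable borel" "AE y in lborel. \<psi>2 y = \<psi>2' y"
      "\<And>s. s > 0 \<Longrightarrow> emeasure lborel {y. s < \<bar>\<psi>2' y\<bar>} < \<infinity>"
    using borel_version[OF S0(2)] by blast
  note [measurable] = \<psi>1'(1) \<psi>2'(1)
  fix s :: real assume "s > 0"
  let ?A = "{x \<in> space borel. s < \<bar>\<psi>2' x\<bar>}" and ?B = "{y \<in> space borel. s < \<bar>\<psi>1' y\<bar>}"
  have "AE y in lborel. AE x in lborel. s < \<bar>g (x, y)\<bar> \<longrightarrow> s < \<bar>\<psi>1' y\<bar>"
    using le1 \<psi>1'(2)
  proof eventually_elim
    case (elim y)
    from elim(1) show ?case by eventually_elim (use elim(2) in auto)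
  qed
  then have "AE x in lborel. AE y in lborel. s < \<bar>g (x, y)\<bar> \<longrightarrow> s < \<bar>\<psi>1' y\<bar>"
    by (rule AE_lborel_commute[THEN iffD1, rotated]) measurable
  moreover have "AE x in lborel. AE y in lborel. s < \<bar>g (x, y)\<bar> \<longrightarrow> s < \<bar>\<psi>2' x\<bar>"
    using le2 \<psi>2'(2)
  proof eventually_elim
    case (elim x)
    from elim(1) show ?case by eventually_elim (use elim(2) in auto)
  qed
  ultimately have "AE x in lborel. AE y in lborel. s < \<bar>g (x, y)\<bar> \<longrightarrow> s < \<bar>\<psi>2' x\<bar> \<and> s < \<bar>\<psi>1' y\<bar>"
  proof eventually_elim
    case (elim x)
    then show ?case by eventually_elim auto
  qed
  then have "AE z in lborel. s < \<bar>g (fst z, snd z)\<bar> \<longrightarrow> s < \<bar>\<psi>2' (fst z)\<bar> \<and> s < \<bar>\<psi>1' (snd z)\<bar>"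
    by (rule AE_lborel_prod_iff[THEN iffD2, rotated]) measurable
  then have "AE z in lborel. z \<in> {z. s < \<bar>g z\<bar>} \<longrightarrow> z \<in> ?A \<times> ?B"
    by eventually_elim (auto simp: mem_Times_iff)
  then have "emeasure lborel {z. s < \<bar>g z\<bar>} \<le> emeasure lborel (?A \<times> ?B)"
  proof (rule emeasure_mono_AE)
    have "?A \<times> ?B \<in> sets (borel \<Otimes>\<^sub>M borel)" by measurable
    then show "?A \<times> ?B \<in> sets lborel" unfolding borel_prod by simp
  qed
  also have "\<dots> = emeasure lborel ?A * emeasure lborel ?B"
    unfolding lborel_prod[symmetric] by (rule lborel.emeasure_pair_measure_Times) auto
  also have "\<dots> < \<infinity>"
    using \<psi>1'(3)[OF \<open>s > 0\<close>] \<psi>2'(3)[OF \<open>s > 0\<close>] by (simp add: ennreal_mult_less_top)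
  finally show "emeasure lebesgue {x. s < \<bar>g x\<bar>} < \<infinity>"
    by (simp add: lborel_level_lebesgue)
qed

lemma Lp1_enorm_eq:
  "Lp1_enorm p f = (\<integral>\<^sup>+ t\<in>{0<..}. ennreal (rearr f t * t powr (1 / p - 1)) \<partial>lborel)"
  unfolding Lp1_enorm_def
  by (intro nn_integral_cong) (auto simp: indicator_def powr_diff mult.commute)

lemma Lp1_enorm_mono:
  assumes "S0 g" "f \<in> borel_measurable lebesgue" "AE x in lebesgue. \<bar>f x\<bar> \<le> \<bar>g x\<bar>"
  shows "Lp1_enorm p f \<le> Lp1_enorm p g"
  unfolding Lp1_enorm_eq
  by (intro nn_integral_mono) (auto simp: indicator_def intro!: ennreal_leI mult_right_mono rearr_mono[OF assms(1) _ assms(2,3)])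

lemma S0_exists_small:
  fixes g :: "'a::euclidean_space \<Rightarrow> real"
  assumes "S0 g" "e > 0" "AE z in lborel. z \<in> Z"
  obtains z where "z \<in> Z" "\<bar>g z\<bar> \<le> e"
proof -
  have "\<exists>z\<in>Z. \<bar>g z\<bar> \<le> e"
  proof (rule ccontr)
    assume *: "\<not> ?thesis"
    have "emeasure lebesgue (UNIV :: 'a set) \<le> emeasure lebesgue {x. e < \<bar>g x\<bar>}"
    proof (rule emeasure_mono_AE)
      have "AE z in lborel. z \<in> UNIV \<longrightarrow> z \<in> {x. e < \<bar>g x\<bar>}"
        using assms(3) by eventually_elim (use * in \<open>auto simp: not_le\<close>)
      then show "AE z in lebesgue. z \<in> UNIV \<longrightarrow> z \<in> {x. e < \<bar>g x\<bar>}"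
        by (simp only: AE_lebesgue_iff)
    qed (use assms in \<open>auto simp: S0_def level_set_lebesgue\<close>)
    also have "\<dots> < \<infinity>"
      using assms by (auto simp: S0_def)
    finally show False by simp
  qed
  then show thesis using that by blast
qed

lemma exact_holder_on_full_set:
  fixes g :: "real \<times> real \<Rightarrow> real"
  assumes "\<alpha> > 0" and g: "g \<in> borel_measurable borel"
    and [measurable]: "\<phi>1 \<in> borel_measurable borel" "\<phi>2 \<in> borel_measurable borel"
    and rows: "AE y in lborel. ae_holder \<alpha> (\<phi>1 y) (\<lambda>x. g (x, y))"
    and cols: "AE x in lborel. ae_holder \<alpha> (\<phi>2 x) (\<lambda>y. g (x, y))"
  obtains Z where "Z \<in> sets borel" "AE z in lborel. z \<in> Z"
    "\<And>x x' y. (x, y) \<in> Z \<Longrightarrow> (x', y) \<in> Z \<Longrightarrow> \<bar>g (x, y) - g (x', y)\<bar> \<le> \<phi>1 y * \<bar>x - x'\<bar> powr \<alpha>"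
    "\<And>x y y'. (x, y) \<in> Z \<Longrightarrow> (x, y') \<in> Z \<Longrightarrow> \<bar>g (x, y) - g (x, y')\<bar> \<le> \<phi>2 x * \<bar>y - y'\<bar> powr \<alpha>"
proof -
  have [measurable]: "g \<in> borel_measurable (borel \<Otimes>\<^sub>M borel)"
    unfolding borel_prod by (rule g)
  define R where "R z \<longleftrightarrow> (AE x' in lborel. \<bar>g (fst z, snd z) - g (x', snd z)\<bar> \<le> \<phi>1 (snd z) * \<bar>fst z - x'\<bar> powr \<alpha>)" for z
  define C where "C z \<longleftrightarrow> (AE y' in lborel. \<bar>g (fst z, snd z) - g (fst z, y')\<bar> \<le> \<phi>2 (fst z) * \<bar>snd z - y'\<bar> powr \<alpha>)" for z
  have R [measurable]: "Measurable.pred (borel \<Otimes>\<^sub>M borel) R"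
    unfolding R_def by (intro pred_AE_lborel) measurable
  have C [measurable]: "Measurable.pred (borel \<Otimes>\<^sub>M borel) C"
    unfolding C_def by (intro pred_AE_lborel) measurable
  have "AE y in lborel. AE x in lborel. R (x, y)"
    using rows by (simp add: R_def ae_holder_def)
  then have "AE x in lborel. AE y in lborel. R (x, y)"
    by (rule AE_lborel_commute[THEN iffD1, rotated]) measurable
  then have AE_R: "AE z in lborel. R (fst z, snd z)"
    by (rule AE_lborel_prod_iff[THEN iffD2, rotated]) measurable
  have "AE x in lborel. AE y in lborel. C (x, y)"
    using cols by (simp add: C_def ae_holder_def)
  then have AE_C: "AE z in lborel. C (fst z, snd z)"
    by (rule AE_lborel_prod_iff[THEN iffD2, rotated]) measurable
  show thesis
  proof
    have "{z \<in> space (borel \<Otimes>\<^sub>M borel). R z \<and> C z} \<in> sets (borel \<Otimes>\<^sub>M borel)"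
      by measurable
    then show "{z. R z \<and> C z} \<in> sets borel"
      unfolding borel_prod by simp
    show "AE z in lborel. z \<in> {z. R z \<and> C z}"
      using AE_R AE_C by eventually_elim simp
    show "\<bar>g (x, y) - g (x', y)\<bar> \<le> \<phi>1 y * \<bar>x - x'\<bar> powr \<alpha>"
      if "(x, y) \<in> {z. R z \<and> C z}" "(x', y) \<in> {z. R z \<and> C z}" for x x' y
      using that \<open>\<alpha> > 0\<close> by (intro holder_of_AE_holder[where f = "\<lambda>x. g (x, y)"]) (auto simp: R_def)
    show "\<bar>g (x, y) - g (x, y')\<bar> \<le> \<phi>2 x * \<bar>y - y'\<bar> powr \<alpha>"
      if "(x, y) \<in> {z. R z \<and> C z}" "(x, y') \<in> {z. R z \<and> C z}" for x y y'
      using that \<open>\<alpha> > 0\<close> by (intro holder_of_AE_holder[where f = "\<lambda>y. g (x, y)"]) (auto simp: C_def)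
  qed
qed

theorem theorem2p1:
  fixes p :: real
  assumes "1 \<le> p"
  shows "\<exists>c>0. \<forall>f. in_Up p f \<longrightarrow>
    (let \<phi>1 = (\<lambda>y. real_of_ereal (lip_semi (1/p) (\<lambda>x. f (x, y))));
         \<phi>2 = (\<lambda>x. real_of_ereal (lip_semi (1/p) (\<lambda>y. f (x, y))))
     in S0 f \<and>
        ess_norm f \<le> ereal (c * (Lp1_norm p \<phi>1 + Lp1_norm p \<phi>2)) \<and>
        (\<exists>g. bounded (range g) \<and> uniformly_continuous_on UNIV g \<and>
             (AE z in lebesgue. f z = g z) \<and>
             (\<forall>\<delta>>0. ennreal (omega g \<delta>) \<le> ennreal c *
                (\<integral>\<^sup>+ t\<in>{0<..\<delta>}. ennreal ((rearr \<phi>1 t + rearr \<phi>2 t) * t powr (1/p - 1)) \<partial>lborel))))"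
proof -
  define \<alpha> where "\<alpha> = 1 / p"
  have \<alpha>: "0 < \<alpha>" "\<alpha> \<le> 1"
    using assms by (auto simp: \<alpha>_def)
  have "S0 f \<and> ess_norm f \<le> ereal (96 * (Lp1_norm p \<phi>1 + Lp1_norm p \<phi>2)) \<and>
      (\<exists>G. bounded (range G) \<and> uniformly_continuous_on UNIV G \<and> (AE z in lebesgue. f z = G z) \<and>
        (\<forall>\<delta>>0. ennreal (omega G \<delta>) \<le> ennreal 96 *
          (\<integral>\<^sup>+ t\<in>{0<..\<delta>}. ennreal ((rearr \<phi>1 t + rearr \<phi>2 t) * t powr (\<alpha> - 1)) \<partial>lborel)))"
    if f: "in_Up p f"
      and \<phi>1_def: "\<phi>1 = (\<lambda>y. real_of_ereal (lip_semi \<alpha> (\<lambda>x. f (x, y))))"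
      and \<phi>2_def: "\<phi>2 = (\<lambda>x. real_of_ereal (lip_semi \<alpha> (\<lambda>y. f (x, y))))" for f \<phi>1 \<phi>2
  proof -
    let ?\<psi>1 = "\<lambda>y. lip_norm \<alpha> (\<lambda>x. f (x, y))" and ?\<psi>2 = "\<lambda>x. lip_norm \<alpha> (\<lambda>y. f (x, y))"
    have f_meas: "f \<in> borel_measurable lebesgue"
      and lip2: "AE x in lborel. in_Lip \<alpha> (\<lambda>y. f (x, y))"
      and lip1: "AE y in lborel. in_Lip \<alpha> (\<lambda>x. f (x, y))"
      and \<psi>1: "in_Lp1 p ?\<psi>1" and \<psi>2: "in_Lp1 p ?\<psi>2"
      using f by (auto simp: in_Up_def \<alpha>_def AE_lebesgue_iff)
    obtain g where g: "g \<in> borel_measurable borel" and f_eq_g: "AE z in lborel. f z = g z"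
      using completion_ex_borel_measurable_real[OF f_meas] by auto
    have eq2: "AE x in lborel. AE y in lborel. f (x, y) = g (x, y)"
      and eq1: "AE y in lborel. AE x in lborel. f (x, y) = g (prod.swap (y, x))"
      using AE_lebesgue_sections[of "\<lambda>z. f z = g z"] f_eq_g by (auto simp: AE_lebesgue_iff)
    have swap: "(\<lambda>z. g (prod.swap z)) \<in> borel_measurable borel"
      by (rule measurable_compose[OF _ g]) (intro borel_measurable_continuous_onI continuous_on_swap)
    define \<theta>1 where "\<theta>1 y = real_of_ereal (lip_semi \<alpha> (\<lambda>x. g (x, y)))" for y
    define \<theta>2 where "\<theta>2 x = real_of_ereal (lip_semi \<alpha> (\<lambda>y. g (x, y)))" for x
    note version2 = lip_sections_borel_version[OF \<alpha>(1) g eq2 lip2, folded \<theta>2_def]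
    note version1 = lip_sections_borel_version[OF \<alpha>(1) swap eq1 lip1, unfolded prod.swap_def fst_conv snd_conv, folded \<theta>1_def]

    have transfer: "S0 \<theta> \<and> rearr \<phi> = rearr \<theta> \<and> Lp1_enorm p \<theta> < \<infinity>"
      if "in_Lp1 p \<psi>" and \<theta>: "\<theta> \<in> borel_measurable borel" and eq: "AE y in lborel. \<phi> y = \<theta> y"
        and le: "AE y in lborel. 0 \<le> \<theta> y \<and> \<theta> y \<le> \<psi> y" for \<phi> \<theta> \<psi> :: "real \<Rightarrow> real"
    proof -
      have \<theta>': "\<theta> \<in> borel_measurable lebesgue"
        using \<theta> by (intro measurable_completion) simp
      then have \<phi>': "\<phi> \<in> borel_measurable lebesgue"
        by (rule borel_measurable_AE) (use eq in \<open>auto simp: AE_lebesgue_iff elim!: eventually_mono\<close>)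
      have le': "AE y in lebesgue. \<bar>\<theta> y\<bar> \<le> \<bar>\<psi> y\<bar>"
        unfolding AE_lebesgue_iff using le by eventually_elim simp
      show ?thesis
        using that(1) S0_mono[OF _ \<theta>' le'] Lp1_enorm_mono[OF _ \<theta>' le', of p] rearr_cong[OF \<phi>' \<theta>'] eq
        by (auto simp: in_Lp1_def AE_lebesgue_iff intro: order.strict_trans1)
    qed
    have \<theta>1: "S0 \<theta>1" "rearr \<phi>1 = rearr \<theta>1" "Lp1_enorm p \<theta>1 < \<infinity>"
      using transfer[OF \<psi>1 version1(1) _ version1(4), of \<phi>1] version1(2) by (auto simp: \<phi>1_def)
    have \<theta>2: "S0 \<theta>2" "rearr \<phi>2 = rearr \<theta>2" "Lp1_enorm p \<theta>2 < \<infinity>"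
      using transfer[OF \<psi>2 version2(1) _ version2(4), of \<phi>2] version2(2) by (auto simp: \<phi>2_def)
    have "S0 g"
      using \<psi>1 \<psi>2 version1(5) version2(5) by (intro S0_of_section_bounds[OF g, of ?\<psi>1 ?\<psi>2]) (auto simp: in_Lp1_def)
    then have "S0 f"
      using f_meas f_eq_g by (intro S0_mono[of g f]) (auto simp: AE_lebesgue_iff elim!: eventually_mono)

    obtain Z' where Z': "Z' \<in> sets borel" "AE z in lborel. z \<in> Z'"
      and row: "\<And>x x' y. (x, y) \<in> Z' \<Longrightarrow> (x', y) \<in> Z' \<Longrightarrow> \<bar>g (x, y) - g (x', y)\<bar> \<le> \<theta>1 y * \<bar>x - x'\<bar> powr \<alpha>"
      and col: "\<And>x y y'. (x, y) \<in> Z' \<Longrightarrow> (x, y') \<in> Z' \<Longrightarrow> \<bar>g (x, y) - g (x, y')\<bar> \<le> \<theta>2 x * \<bar>y - y'\<bar> powr \<alpha>"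
      using exact_holder_on_full_set[OF \<alpha>(1) g version1(1) version2(1) version1(3) version2(3)] by metis
    obtain Z where Z: "Z \<subseteq> Z'" "AE z in lborel. z \<in> Z"
      and sect: "\<And>x y. (x, y) \<in> Z \<Longrightarrow> AE y' in lborel. (x, y') \<in> Z" "\<And>x y. (x, y) \<in> Z \<Longrightarrow> AE x' in lborel. (x', y) \<in> Z"
      using AE_full_core[OF Z'] by metis

    define M where "M t = rearr \<theta>1 t + rearr \<theta>2 t" for t
    have level: "emeasure lborel {y. m < \<theta> y} \<le> ennreal t"
      if "S0 \<theta>" "\<theta> \<in> borel_measurable borel" "t > 0" "rearr \<theta> t \<le> m" for \<theta> :: "real \<Rightarrow> real" and t m
    proof -
      have "{y. rearr \<theta> t < \<bar>\<theta> y\<bar>} \<in> sets borel"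
        using that(2) by measurable
      then have "emeasure lborel {y. m < \<theta> y} \<le> emeasure lborel {y. rearr \<theta> t < \<bar>\<theta> y\<bar>}"
        using that(4) by (intro emeasure_mono) auto
      also have "\<dots> \<le> ennreal t"
        using emeasure_rearr_le[OF that(1,3)] by (simp add: lborel_level_lebesgue[OF that(2)])
      finally show ?thesis .
    qed
    note [measurable] = borel_measurable_rearr[OF \<theta>1(1)] borel_measurable_rearr[OF \<theta>2(1)]
    have [measurable]: "M \<in> borel_measurable borel"
      unfolding M_def by measurable
    interpret grid_descent g \<theta>1 \<theta>2 M \<alpha> Z
    proof
      show "emeasure lborel {y. M t < \<theta>1 y} \<le> ennreal t" if "t > 0" for t
        using that rearr_nonneg[OF \<theta>2(1) that] by (intro level \<theta>1 version1) (auto simp: M_def)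
      show "emeasure lborel {x. M t < \<theta>2 x} \<le> ennreal t" if "t > 0" for t
        using that rearr_nonneg[OF \<theta>1(1) that] by (intro level \<theta>2 version2) (auto simp: M_def)
      show "\<bar>g (x, y) - g (x', y)\<bar> \<le> \<theta>1 y * \<bar>x - x'\<bar> powr \<alpha>" if "(x, y) \<in> Z" "(x', y) \<in> Z" for x x' y
        using that Z(1) by (intro row) auto
      show "\<bar>g (x, y) - g (x, y')\<bar> \<le> \<theta>2 x * \<bar>y - y'\<bar> powr \<alpha>" if "(x, y) \<in> Z" "(x, y') \<in> Z" for x y y'
        using that Z(1) by (intro col) auto
    qed (use \<alpha> version1(1) version2(1) sect in
          \<open>auto simp: M_def intro!: add_nonneg_nonneg rearr_nonneg add_mono rearr_antimono \<theta>1(1) \<theta>2(1)\<close>)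

    define N where "N = Lp1_norm p \<phi>1 + Lp1_norm p \<phi>2"
    have enorm_eq: "Lp1_enorm p \<phi>1 = Lp1_enorm p \<theta>1" "Lp1_enorm p \<phi>2 = Lp1_enorm p \<theta>2"
      by (simp_all add: Lp1_enorm_def \<theta>1(2) \<theta>2(2))
    have "(\<integral>\<^sup>+ t\<in>{0<..}. ennreal (M t * t powr (\<alpha> - 1)) \<partial>lborel)
        = (\<integral>\<^sup>+ t. ennreal (rearr \<theta>1 t * t powr (1 / p - 1)) * indicator {0<..} t
              + ennreal (rearr \<theta>2 t * t powr (1 / p - 1)) * indicator {0<..} t \<partial>lborel)"
      using rearr_nonneg[OF \<theta>1(1)] rearr_nonneg[OF \<theta>2(1)]
      by (intro nn_integral_cong) (auto simp: M_def \<alpha>_def indicator_def distrib_right ennreal_plus)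
    also have "\<dots> = Lp1_enorm p \<theta>1 + Lp1_enorm p \<theta>2"
      unfolding Lp1_enorm_eq by (rule nn_integral_add) measurable
    also have "\<dots> = ennreal N"
      using \<theta>1(3) \<theta>2(3) by (simp add: N_def Lp1_norm_def enorm_eq ennreal_plus)
    finally have total: "(\<integral>\<^sup>+ t\<in>{0<..}. ennreal (M t * t powr (\<alpha> - 1)) \<partial>lborel) = ennreal N" .
    have "N \<ge> 0"
      by (simp add: N_def Lp1_norm_def)
    have W_le: "W \<delta> \<le> ennreal N" for \<delta>
      unfolding W_def total[symmetric] by (intro nn_integral_mono) (auto simp: indicator_def)

    have bdd: "\<bar>g z\<bar> \<le> 96 * N" if "z \<in> Z" for z
    proof (rule field_le_epsilon)
      fix e :: real assume "e > 0"
      then obtain z' where z': "z' \<in> Z" "\<bar>g z'\<bar> \<le> e"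
        using S0_exists_small[OF \<open>S0 g\<close> _ Z(2)] by blast
      have "ennreal \<bar>g z - g z'\<bar> \<le> 96 * W (\<bar>fst z - fst z'\<bar> + \<bar>snd z - snd z'\<bar> + 1)"
        using that z'(1) by (intro oscillation_le) auto
      also have "\<dots> \<le> 96 * ennreal N"
        by (intro mult_left_mono W_le) auto
      also have "\<dots> = ennreal (96 * N)"
        using \<open>N \<ge> 0\<close> by (simp add: ennreal_mult)
      finally have "\<bar>g z - g z'\<bar> \<le> 96 * N"
        using \<open>N \<ge> 0\<close> by (simp add: ennreal_le_iff)
      with z'(2) show "\<bar>g z\<bar> \<le> 96 * N + e" by linarith
    qed

    have V0: "(\<lambda>n. 96 * W (1 / real (Suc n))) \<longlonglongrightarrow> 0"
    proof -
      have "(\<lambda>n. W (1 / real (Suc n))) \<longlonglongrightarrow> 0"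
        unfolding W_def by (rule nn_integral_Ioc_tendsto_0) (simp_all add: total)
      then have "(\<lambda>n. 96 * W (1 / real (Suc n))) \<longlonglongrightarrow> 96 * 0"
        by (intro ennreal_tendsto_cmult) auto
      then show ?thesis by simp
    qed
    have "\<exists>G. bounded (range G) \<and> uniformly_continuous_on UNIV G \<and> (\<forall>z\<in>Z. G z = g z) \<and>
        (\<forall>\<delta>>0. ennreal (omega G \<delta>) \<le> 96 * W \<delta>)"
      by (rule modulus_extension[of Z g "\<lambda>\<delta>. 96 * W \<delta>" "96 * N", OF Z(2) oscillation_le V0 bdd])
    then obtain G where G: "bounded (range G)" "uniformly_continuous_on UNIV G" "\<forall>z\<in>Z. G z = g z"
        "\<forall>\<delta>>0. ennreal (omega G \<delta>) \<le> 96 * W \<delta>"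
      by blast
    have "AE z in lebesgue. f z = G z"
      unfolding AE_lebesgue_iff using f_eq_g Z(2) by eventually_elim (simp add: G(3))
    moreover have "ess_norm f \<le> ereal (96 * N)"
      unfolding ess_norm_le_iff AE_lebesgue_iff using f_eq_g Z(2) by eventually_elim (simp add: bdd)
    moreover have "\<forall>\<delta>>0. ennreal (omega G \<delta>) \<le> ennreal 96 *
          (\<integral>\<^sup>+ t\<in>{0<..\<delta>}. ennreal ((rearr \<phi>1 t + rearr \<phi>2 t) * t powr (\<alpha> - 1)) \<partial>lborel)"
      using G(4) by (simp add: W_def M_def \<theta>1(2) \<theta>2(2))
    ultimately show ?thesis
      using \<open>S0 f\<close> G(1,2) unfolding N_def by blast
  qed
  then show ?thesis
    unfolding Let_def \<alpha>_def by (intro exI[of _ 96]) simp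
qed

end
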